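(* Let $H$ be a subgroup of a finite group $G$. The $H$-global $G$-partial representations are in one-to-one correspondence with the (usual) representations of the algebra $\mathbb{C}\Gamma_H(G)$, and this correspondence is an isomorphism of categories. More precisely, any algebra homomorphism $\tilde\pi\colon\mathbb{C}\Gamma_H(G)\to\operatorname{End}(V)$ determines an $H$-global $G$-partial representation $(V,\pi)$ with $\pi:=\tilde\pi\circ\mu_p$; conversely, given an $H$-global $G$-partial representation $(V,\pi)$, there exists a unique algebra homomorphism $\tilde\pi\colon\mathbb{C}\Gamma_H(G)\to\operatorname{End}(V)$ such that $\pi=\tilde\pi\circ\mu_p$.
   Context: All groups are finite, all vector spaces carrying representations are finite-dimensional over $\mathbb{C}$, algebra homomorphisms are unital. A $G$-partial representation $(V,\pi)$ on a vector space $V$ is a map $\pi\colon G\to\operatorname{End}(V)$ such that for all $g,h\in G$: $\pi(1_G)=\mathrm{Id}_V$; $\pi(g^{-1})\pi(gh)=\pi(g^{-1})\pi(g)\pi(h)$; $\pi(gh)\pi(h^{-1})=\pi(g)\pi(h)\pi(h^{-1})$. It is $H$-global if the restriction of $\pi$ to $H$ is a (usual) representation of $H$. A morphism $(V,\pi)\to(V',\pi')$ is a linear map $f$ with $f\circ\pi(g)=\pi'(g)\circ f$ for all $g\in G$. $\mathcal{P}_H(G/H):=\{A\subseteq G\mid H\subseteq A\text{ and }A\text{ is a union of left cosets of }H\}$. $\Gamma_H(G):=\{(A,g)\in\mathcal{P}_H(G/H)\times G\mid g^{-1}\in A\}$ is the groupoid with operation $(A,g)\cdot(B,h):=(B,gh)$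 if $A=hB$, and undefined otherwise. The groupoid algebra $\mathbb{C}\Gamma_H(G)$ has $\Gamma_H(G)$ as $\mathbb{C}$-basis, with products that are undefined in $\Gamma_H(G)$ set to $0$; its unit is $\sum_{A}(A,1_G)$. The map $\mu_p\colon G\to\mathbb{C}\Gamma_H(G)$ is $\mu_p(g):=\sum_{A\in\mathcal{P}_H(G/H),\,A\ni g^{-1}}(A,g)$. *)

theory Defs
  imports
    Complex_Main
    "HOL-Algebra.Left_Coset"
    "Jordan_Normal_Form.VS_Connect"
begin

section \<open>Categories\<close>

text \<open>Hom-sets are indexed by a pair of objects and need not be disjoint, so composition,
  functors and so on take the objects as additional arguments: \<open>Comp C x y z g f\<close> is the composite
  of \<open>f \<in> Hom C x y\<close> and \<open>g \<in> Hom C y z\<close>.\<close>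

record ('o, 'm) cat =
  Ob :: "'o set"
  Hom :: "'o \<Rightarrow> 'o \<Rightarrow> 'm set"
  Id :: "'o \<Rightarrow> 'm"
  Comp :: "'o \<Rightarrow> 'o \<Rightarrow> 'o \<Rightarrow> 'm \<Rightarrow> 'm \<Rightarrow> 'm"

definition is_category :: "('o, 'm) cat \<Rightarrow> bool" where
  "is_category C \<longleftrightarrow>
     (\<forall>x\<in>Ob C. Id C x \<in> Hom C x x) \<and>
     (\<forall>x\<in>Ob C. \<forall>y\<in>Ob C. \<forall>z\<in>Ob C. \<forall>f\<in>Hom C x y. \<forall>g\<in>Hom C y z.
        Comp C x y z g f \<in> Hom C x z) \<and>
     (\<forall>x\<in>Ob C. \<forall>y\<in>Ob C. \<forall>f\<in>Hom C x y.
        Comp C x x y f (Id C x) = f \<and> Comp C x y y (Id C y) f = f) \<and>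
     (\<forall>w\<in>Ob C. \<forall>x\<in>Ob C. \<forall>y\<in>Ob C. \<forall>z\<in>Ob C.
        \<forall>f\<in>Hom C w x. \<forall>g\<in>Hom C x y. \<forall>h\<in>Hom C y z.
        Comp C w x z (Comp C x y z h g) f = Comp C w y z h (Comp C w x y g f))"

definition is_functor ::
  "('o, 'm) cat \<Rightarrow> ('p, 'n) cat \<Rightarrow> ('o \<Rightarrow> 'p) \<Rightarrow> ('o \<Rightarrow> 'o \<Rightarrow> 'm \<Rightarrow> 'n) \<Rightarrow> bool" where
  "is_functor C D Fo Fm \<longleftrightarrow>
     is_category C \<and> is_category D \<and>
     (\<forall>x\<in>Ob C. Fo x \<in> Ob D) \<and>
     (\<forall>x\<in>Ob C. \<forall>y\<in>Ob C. \<forall>f\<in>Hom C x y. Fm x y f \<in> Hom D (Fo x) (Fo y)) \<and>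
     (\<forall>x\<in>Ob C. Fm x x (Id C x) = Id D (Fo x)) \<and>
     (\<forall>x\<in>Ob C. \<forall>y\<in>Ob C. \<forall>z\<in>Ob C. \<forall>f\<in>Hom C x y. \<forall>g\<in>Hom C y z.
        Fm x z (Comp C x y z g f) = Comp D (Fo x) (Fo y) (Fo z) (Fm y z g) (Fm x y f))"

definition is_left_inverse_functor ::
  "('o, 'm) cat \<Rightarrow> ('o \<Rightarrow> 'p) \<Rightarrow> ('o \<Rightarrow> 'o \<Rightarrow> 'm \<Rightarrow> 'n) \<Rightarrow>
   ('p \<Rightarrow> 'o) \<Rightarrow> ('p \<Rightarrow> 'p \<Rightarrow> 'n \<Rightarrow> 'm) \<Rightarrow> bool" where
  "is_left_inverse_functor C Fo Fm Go Gm \<longleftrightarrow>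
     (\<forall>x\<in>Ob C. Go (Fo x) = x) \<and>
     (\<forall>x\<in>Ob C. \<forall>y\<in>Ob C. \<forall>f\<in>Hom C x y. Gm (Fo x) (Fo y) (Fm x y f) = f)"

definition isomorphism_of_categories ::
  "('o, 'm) cat \<Rightarrow> ('p, 'n) cat \<Rightarrow> ('o \<Rightarrow> 'p) \<Rightarrow> ('o \<Rightarrow> 'o \<Rightarrow> 'm \<Rightarrow> 'n) \<Rightarrow> bool" where
  "isomorphism_of_categories C D Fo Fm \<longleftrightarrow>
     is_functor C D Fo Fm \<and>
     (\<exists>Go Gm. is_functor D C Go Gm \<and>
        is_left_inverse_functor C Fo Fm Go Gm \<and> is_left_inverse_functor D Go Gm Fo Fm)"

section \<open>Vector spaces and algebras over the complex numbers\<close>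

abbreviation complex_field :: "complex ring" where
  "complex_field \<equiv> class_ring"

text \<open>A vector space is a module record whose carrier is a subset of an arbitrary type \<open>'v\<close>.
  The ring multiplication and unit of that record are ignored. An algebra is a module record
  in which they are used.\<close>

definition fin_dim_vs :: "(complex, 'v) module \<Rightarrow> bool" where
  "fin_dim_vs V \<longleftrightarrow> vectorspace complex_field V \<and> vectorspace.fin_dim complex_field V"

text \<open>All maps are required to be extensional (\<open>undefined\<close> outside their domain), so that
  equality of HOL functions is equality of maps on the domain.\<close>

definition linear_maps ::
  "(complex, 'v) module \<Rightarrow> (complex, 'w) module \<Rightarrow> ('v \<Rightarrow> 'w) set" where
  "linear_maps V W = LinearCombinations.module_hom complex_field V W \<inter> extensional (carrier V)"

definition End_alg :: "(complex, 'v) module \<Rightarrow> (complex, 'v \<Rightarrow> 'v) module" where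
  "End_alg V = \<lparr>
     carrier = linear_maps V V,
     mult = compose (carrier V),
     one = (\<lambda>v\<in>carrier V. v),
     zero = (\<lambda>v\<in>carrier V. \<zero>\<^bsub>V\<^esub>),
     add = (\<lambda>f g. \<lambda>v\<in>carrier V. f v \<oplus>\<^bsub>V\<^esub> g v),
     smult = (\<lambda>c f. \<lambda>v\<in>carrier V. c \<odot>\<^bsub>V\<^esub> f v)\<rparr>"

text \<open>\<open>ring_hom\<close> includes preservation of the unit.\<close>

definition alg_homs ::
  "(complex, 'a) module \<Rightarrow> (complex, 'b) module \<Rightarrow> ('a \<Rightarrow> 'b) set" where
  "alg_homs A B = Ring.ring_hom A B \<inter> LinearCombinations.module_hom complex_field A B \<inter> extensional (carrier A)"

section \<open>Partial representations\<close>

definition partial_rep ::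
  "('g, 'b) monoid_scheme \<Rightarrow> (complex, 'v) module \<Rightarrow> ('g \<Rightarrow> 'v \<Rightarrow> 'v) \<Rightarrow> bool" where
  "partial_rep G V \<pi> \<longleftrightarrow>
     fin_dim_vs V \<and>
     \<pi> \<in> carrier G \<rightarrow>\<^sub>E carrier (End_alg V) \<and>
     \<pi> \<one>\<^bsub>G\<^esub> = \<one>\<^bsub>End_alg V\<^esub> \<and>
     (\<forall>g\<in>carrier G. \<forall>h\<in>carrier G.
        \<pi> (inv\<^bsub>G\<^esub> g) \<otimes>\<^bsub>End_alg V\<^esub> \<pi> (g \<otimes>\<^bsub>G\<^esub> h)
          = \<pi> (inv\<^bsub>G\<^esub> g) \<otimes>\<^bsub>End_alg V\<^esub> \<pi> g \<otimes>\<^bsub>End_alg V\<^esub> \<pi> h) \<and>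
     (\<forall>g\<in>carrier G. \<forall>h\<in>carrier G.
        \<pi> (g \<otimes>\<^bsub>G\<^esub> h) \<otimes>\<^bsub>End_alg V\<^esub> \<pi> (inv\<^bsub>G\<^esub> h)
          = \<pi> g \<otimes>\<^bsub>End_alg V\<^esub> \<pi> h \<otimes>\<^bsub>End_alg V\<^esub> \<pi> (inv\<^bsub>G\<^esub> h))"

text \<open>The group of units of \<open>End_alg V\<close> is \<open>GL(V)\<close>.\<close>

definition global_partial_rep ::
  "('g, 'b) monoid_scheme \<Rightarrow> 'g set \<Rightarrow> (complex, 'v) module \<Rightarrow> ('g \<Rightarrow> 'v \<Rightarrow> 'v) \<Rightarrow> bool" where
  "global_partial_rep G H V \<pi> \<longleftrightarrow>
     partial_rep G V \<pi> \<and> restrict \<pi> H \<in> hom (G\<lparr>carrier := H\<rparr>) (units_of (End_alg V))"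

section \<open>The groupoid and its algebra\<close>

definition coset_unions :: "('g, 'b) monoid_scheme \<Rightarrow> 'g set \<Rightarrow> 'g set set" where
  "coset_unions G H = {A. A \<subseteq> carrier G \<and> H \<subseteq> A \<and> (\<exists>S \<subseteq> lcosets\<^bsub>G\<^esub> H. A = \<Union>S)}"

definition Gamma :: "('g, 'b) monoid_scheme \<Rightarrow> 'g set \<Rightarrow> ('g set \<times> 'g) set" where
  "Gamma G H = {(A, g). A \<in> coset_unions G H \<and> g \<in> carrier G \<and> inv\<^bsub>G\<^esub> g \<in> A}"

text \<open>\<open>None\<close> stands for an undefined product.\<close>

fun Gamma_mult ::
  "('g, 'b) monoid_scheme \<Rightarrow> 'g set \<times> 'g \<Rightarrow> 'g set \<times> 'g \<Rightarrow> ('g set \<times> 'g) option" where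
  "Gamma_mult G (A, g) (B, h) =
     (if A = h <#\<^bsub>G\<^esub> B then Some (B, g \<otimes>\<^bsub>G\<^esub> h) else None)"

definition basis_vec :: "'x \<Rightarrow> 'x \<Rightarrow> complex" where
  "basis_vec x = (\<lambda>z. if z = x then 1 else 0)"

text \<open>An element \<open>\<Sum>x\<in>\<Gamma>. a\<^sub>x x\<close> of the algebra is represented by its coefficient function
  \<open>x \<mapsto> a\<^sub>x\<close>, which is zero outside the (finite) groupoid; \<open>basis_vec x\<close> represents the basis
  element \<open>x\<close>. The product is the bilinear extension of the product of the groupoid, with
  undefined products set to zero.\<close>

definition Gamma_alg ::
  "('g, 'b) monoid_scheme \<Rightarrow> 'g set \<Rightarrow> (complex, 'g set \<times> 'g \<Rightarrow> complex) module" where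
  "Gamma_alg G H = \<lparr>
     carrier = {a. \<forall>x. x \<notin> Gamma G H \<longrightarrow> a x = 0},
     mult = (\<lambda>a b z. \<Sum>x\<in>Gamma G H. \<Sum>y\<in>Gamma G H.
               a x * b y * (case Gamma_mult G x y of None \<Rightarrow> 0 | Some w \<Rightarrow> basis_vec w z)),
     one = (\<lambda>z. \<Sum>A\<in>coset_unions G H. basis_vec (A, \<one>\<^bsub>G\<^esub>) z),
     zero = (\<lambda>z. 0),
     add = (\<lambda>a b z. a z + b z),
     smult = (\<lambda>c a z. c * a z)\<rparr>"

definition mu_p ::
  "('g, 'b) monoid_scheme \<Rightarrow> 'g set \<Rightarrow> 'g \<Rightarrow> 'g set \<times> 'g \<Rightarrow> complex" where
  "mu_p G H g = (\<lambda>z. \<Sum>A\<in>{A \<in> coset_unions G H. inv\<^bsub>G\<^esub> g \<in> A}. basis_vec (A, g) z)"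

section \<open>The two categories\<close>

text \<open>Objects are pairs \<open>(V, \<rho>)\<close> where \<open>\<rho>\<close> maps \<open>X\<close> to endomorphisms of \<open>V\<close>; morphisms are
  linear maps \<open>f\<close> with \<open>f \<circ> \<rho> x = \<sigma> x \<circ> f\<close> for all \<open>x \<in> X\<close>.\<close>

definition rep_category ::
  "'x set \<Rightarrow> ((complex, 'v) module \<times> ('x \<Rightarrow> 'v \<Rightarrow> 'v)) set \<Rightarrow>
   ((complex, 'v) module \<times> ('x \<Rightarrow> 'v \<Rightarrow> 'v), 'v \<Rightarrow> 'v) cat" where
  "rep_category X obs = \<lparr>
     Ob = obs,
     Hom = (\<lambda>(V, \<rho>) (W, \<sigma>). {f \<in> linear_maps V W.
              \<forall>x\<in>X. compose (carrier V) f (\<rho> x) = compose (carrier V) (\<sigma> x) f}),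
     Id = (\<lambda>(V, \<rho>). \<lambda>v\<in>carrier V. v),
     Comp = (\<lambda>(U, _) _ _ g f. compose (carrier U) g f)\<rparr>"

definition alg_rep_category ::
  "(complex, 'a) module \<Rightarrow>
   ((complex, 'v) module \<times> ('a \<Rightarrow> 'v \<Rightarrow> 'v), 'v \<Rightarrow> 'v) cat" where
  "alg_rep_category A =
     rep_category (carrier A) {(V, \<rho>). fin_dim_vs V \<and> \<rho> \<in> alg_homs A (End_alg V)}"

definition global_partial_rep_category ::
  "('g, 'b) monoid_scheme \<Rightarrow> 'g set \<Rightarrow>
   ((complex, 'v) module \<times> ('g \<Rightarrow> 'v \<Rightarrow> 'v), 'v \<Rightarrow> 'v) cat" where
  "global_partial_rep_category G H =
     rep_category (carrier G) {(V, \<pi>). global_partial_rep G H V \<pi>}"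

end

theory Submission
  imports Defs
begin

text \<open>
  Let \<open>\<pi>\<close> be a partial representation. The elements \<open>e x = \<pi> x \<pi> x\<^sup>-\<^sup>1\<close> are commuting idempotents with
  \<open>\<pi> g (e x) = e (g x) (\<pi> g)\<close>. They split the unit into orthogonal idempotents \<open>F A\<close>, indexed by the
  subsets \<open>A\<close> of \<open>G\<close>, where \<open>e x\<close> acts on \<open>F A\<close> as \<open>1\<close> if \<open>x \<in> A\<close> and as \<open>0\<close> otherwise. If \<open>\<pi>\<close> is
  \<open>H\<close>-global then \<open>e (x h) = e x\<close> and \<open>e h = 1\<close> for \<open>h \<in> H\<close>, so \<open>F A = 0\<close> unless \<open>A\<close> is a union of left
  cosets containing \<open>H\<close>, and \<open>(A, g) \<mapsto> \<pi> g (F A)\<close> extends linearly to the required algebra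
  homomorphism. Uniqueness, and the fact that both categories have the same morphisms, hold because
  the image of \<open>\<mu>\<^sub>p\<close> generates the algebra: the set of elements on which a linear map intertwines two
  representations is a subalgebra.
\<close>

section \<open>Resolutions of the unit by commuting idempotents\<close>

text \<open>For commuting idempotents \<open>e x\<close>, this models \<open>F A\<close> as the
  product of all \<open>e x\<close> with x in A and all \<open>\<one> \<ominus> e x\<close> with x
  outside A. It records left and right eigenvalues instead of an explicit product, which would need
  an order on the factors in a noncommutative ring.\<close>

definition resolution ::
  "('a, 'm) ring_scheme \<Rightarrow> 'x set \<Rightarrow> ('x \<Rightarrow> 'a) \<Rightarrow> ('x set \<Rightarrow> 'a) \<Rightarrow> bool" where
  "resolution R X e F \<longleftrightarrow>
     F \<in> Pow X \<rightarrow> carrier R \<and>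
     (\<forall>A\<subseteq>X. \<forall>x\<in>X. e x \<otimes>\<^bsub>R\<^esub> F A = (if x \<in> A then F A else \<zero>\<^bsub>R\<^esub>)) \<and>
     (\<forall>A\<subseteq>X. \<forall>x\<in>X. F A \<otimes>\<^bsub>R\<^esub> e x = (if x \<in> A then F A else \<zero>\<^bsub>R\<^esub>)) \<and>
     (\<Oplus>\<^bsub>R\<^esub>A\<in>Pow X. F A) = \<one>\<^bsub>R\<^esub>"

context ring
begin

text \<open>Each new idempotent splits every old \<open>F A\<close> in two. The second clause
  strengthens the induction: applied to the new idempotent \<open>e x\<close>, it lets
  \<open>e x\<close> pass the old \<open>F A\<close>.\<close>

lemma resolution_exists_commuting:
  assumes "finite X" and "e \<in> X \<rightarrow> carrier R"
    and "\<And>x. x \<in> X \<Longrightarrow> e x \<otimes> e x = e x"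
    and "\<And>x y. x \<in> X \<Longrightarrow> y \<in> X \<Longrightarrow> e x \<otimes> e y = e y \<otimes> e x"
  shows "\<exists>F. resolution R X e F \<and>
    (\<forall>z\<in>carrier R. (\<forall>x\<in>X. z \<otimes> e x = e x \<otimes> z) \<longrightarrow> (\<forall>A\<subseteq>X. z \<otimes> F A = F A \<otimes> z))"
  using assms
proof (induction X rule: finite_induct)
  case empty
  have "(\<Oplus>A\<in>Pow {}. \<one>) = \<one>"
    by simp
  then show ?case
    by (intro exI[of _ "\<lambda>_. \<one>"]) (auto simp: resolution_def)
next
  case (insert x X)
  have "\<exists>F. resolution R X e F \<and>
    (\<forall>z\<in>carrier R. (\<forall>x\<in>X. z \<otimes> e x = e x \<otimes> z) \<longrightarrow> (\<forall>A\<subseteq>X. z \<otimes> F A = F A \<otimes> z))"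
    by (rule insert.IH) (use insert.prems in auto)
  then obtain F where F: "resolution R X e F"
    and comm0: "\<forall>z\<in>carrier R. (\<forall>x\<in>X. z \<otimes> e x = e x \<otimes> z) \<longrightarrow> (\<forall>A\<subseteq>X. z \<otimes> F A = F A \<otimes> z)"
    by (elim exE conjE)
  have comm: "\<And>z A. z \<in> carrier R \<Longrightarrow> (\<And>x. x \<in> X \<Longrightarrow> z \<otimes> e x = e x \<otimes> z) \<Longrightarrow> A \<subseteq> X \<Longrightarrow>
      z \<otimes> F A = F A \<otimes> z"
    using comm0 by blast
  have FC [simp]: "\<And>A. A \<subseteq> X \<Longrightarrow> F A \<in> carrier R"
    and eF: "\<And>A y. A \<subseteq> X \<Longrightarrow> y \<in> X \<Longrightarrow> e y \<otimes> F A = (if y \<in> A then F A else \<zero>)"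
    and Fe: "\<And>A y. A \<subseteq> X \<Longrightarrow> y \<in> X \<Longrightarrow> F A \<otimes> e y = (if y \<in> A then F A else \<zero>)"
    and sumF: "(\<Oplus>A\<in>Pow X. F A) = \<one>"
    using F by (auto simp: resolution_def)
  have ec: "\<And>y. y \<in> insert x X \<Longrightarrow> e y \<in> carrier R"
    using insert.prems by blast
  have exC [simp]: "e x \<in> carrier R"
    using ec by blast
  define e' where "e' = \<one> \<ominus> e x"
  have e'C [simp]: "e' \<in> carrier R"
    by (simp add: e'_def)
  have split: "e x \<oplus> e' = \<one>"
    by (simp add: e'_def minus_eq a_comm[of \<one>] r_neg1 a_assoc[symmetric] r_neg)
  have idem: "e x \<otimes> e x = e x"
    using insert.prems by blast
  have orth: "e x \<otimes> e' = \<zero>" "e' \<otimes> e x = \<zero>"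
    by (simp_all add: e'_def minus_eq r_distr l_distr r_minus l_minus idem r_neg)
  have xF: "e x \<otimes> F A = F A \<otimes> e x" if "A \<subseteq> X" for A
    by (rule comm[OF exC _ that]) (use insert.prems in blast)
  have comm': "z \<otimes> e' = e' \<otimes> z" if "z \<in> carrier R" "z \<otimes> e x = e x \<otimes> z" for z
    using that by (simp add: e'_def minus_eq r_distr l_distr r_minus l_minus)
  have e'F: "e' \<otimes> F A = F A \<otimes> e'" if "A \<subseteq> X" for A
    using comm'[of "F A"] xF[of A] that by simp
  \<comment> \<open>Every old \<open>F B\<close> splits into \<open>e x \<otimes> F B\<close>, now
    indexed by \<open>insert x B\<close>, and \<open>e' \<otimes> F B\<close>, still indexed by
    B.\<close>
  define F' where "F' A = (if x \<in> A then e x \<otimes> F (A - {x}) else e' \<otimes> F A)" for A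
  have in1: "A - {x} \<subseteq> X" if "A \<subseteq> insert x X" for A
    using that by blast
  have in2: "A \<subseteq> X" if "A \<subseteq> insert x X" "x \<notin> A" for A
    using that by blast
  have F'C: "F' A \<in> carrier R" if "A \<subseteq> insert x X" for A
    using in1[OF that] in2[OF that] by (simp add: F'_def)
  have commF': "z \<otimes> F' A = F' A \<otimes> z"
    if z: "z \<in> carrier R" "\<And>y. y \<in> insert x X \<Longrightarrow> z \<otimes> e y = e y \<otimes> z" and A: "A \<subseteq> insert x X" for z A
  proof -
    \<comment> \<open>Both branches of \<open>F'\<close> have the form
      \<open>u \<otimes> F B\<close> with u either \<open>e x\<close> or \<open>e'\<close>, so this
      form is treated once.\<close>
    have 1: "z \<otimes> (u \<otimes> F B) = u \<otimes> F B \<otimes> z"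
      if "u \<in> carrier R" "z \<otimes> u = u \<otimes> z" "B \<subseteq> X" for u B
    proof -
      have "z \<otimes> (u \<otimes> F B) = u \<otimes> (z \<otimes> F B)"
        using that z(1) by (simp flip: m_assoc)
      also have "\<dots> = u \<otimes> (F B \<otimes> z)"
        using comm[OF z(1) _ that(3)] z(2) by simp
      finally show ?thesis
        using that z(1) by (simp add: m_assoc)
    qed
    show ?thesis
      unfolding F'_def using 1[OF exC _ in1[OF A]] 1[OF e'C _ in2[OF A]] z comm' by simp
  qed
  have eF': "e y \<otimes> F' A = (if y \<in> A then F' A else \<zero>)"
    if A: "A \<subseteq> insert x X" and y: "y \<in> insert x X" for A y
  proof (cases "y = x")
    case True
    then show ?thesis
      using in1[OF A] in2[OF A] by (simp add: F'_def idem orth flip: m_assoc)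
  next
    case False
    then have yX: "y \<in> X"
      using y by simp
    have yx: "e y \<otimes> e x = e x \<otimes> e y"
      using insert.prems y by blast
    have 1: "e y \<otimes> (u \<otimes> F B) = (if y \<in> B then u \<otimes> F B else \<zero>)"
      if "u \<in> carrier R" "e y \<otimes> u = u \<otimes> e y" "B \<subseteq> X" for u B
    proof -
      have "e y \<otimes> (u \<otimes> F B) = u \<otimes> (e y \<otimes> F B)"
        using that ec[OF y] by (simp flip: m_assoc)
      then show ?thesis
        using eF[OF that(3) yX] that by simp
    qed
    show ?thesis
      unfolding F'_def
      using 1[OF exC yx in1[OF A]] 1[OF e'C comm'[OF ec[OF y] yx] in2[OF A]] False by simp
  qed
  \<comment> \<open>The commutation property at \<open>z = e y\<close> turns left eigenvalues into
    right ones.\<close>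
  have F'e: "F' A \<otimes> e y = (if y \<in> A then F' A else \<zero>)"
    if A: "A \<subseteq> insert x X" and y: "y \<in> insert x X" for A y
    using eF'[OF A y] commF'[OF ec[OF y] _ A] insert.prems(3)[OF y] by simp
  have inj: "inj_on (insert x) (Pow X)"
    using insert.hyps by (auto simp: inj_on_def)
  have minus: "A - {x} = A" if "A \<subseteq> X" for A
    using that insert.hyps by blast
  \<comment> \<open>The subsets without x will sum to \<open>e'\<close> and those with x to
    \<open>e x\<close>; together they give the unit.\<close>
  have "(\<Oplus>A\<in>Pow (insert x X). F' A) = (\<Oplus>A\<in>Pow X. F' A) \<oplus> (\<Oplus>A\<in>insert x ` Pow X. F' A)"
    unfolding Pow_insert using insert.hyps by (intro finsum_Un_disjoint) (auto intro!: F'C)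
  also have "(\<Oplus>A\<in>insert x ` Pow X. F' A) = (\<Oplus>A\<in>Pow X. F' (insert x A))"
    by (intro finsum_reindex inj) (auto intro!: F'C)
  also have "\<dots> = (\<Oplus>A\<in>Pow X. e x \<otimes> F A)"
    by (intro finsum_cong') (auto simp: F'_def minus)
  also have "\<dots> = e x"
    using finsum_rdistr[of "Pow X" "e x" F] insert.hyps sumF by (simp add: Pi_def)
  also have "(\<Oplus>A\<in>Pow X. F' A) = (\<Oplus>A\<in>Pow X. e' \<otimes> F A)"
    using insert.hyps by (intro finsum_cong') (auto simp: F'_def)
  also have "\<dots> = e'"
    using finsum_rdistr[of "Pow X" e' F] insert.hyps sumF by (simp add: Pi_def)
  finally have "(\<Oplus>A\<in>Pow (insert x X). F' A) = \<one>"
    using split by (simp add: a_comm)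
  then have "resolution R (insert x X) e F'"
    unfolding resolution_def by (intro conjI allI impI ballI Pi_I F'C eF' F'e) auto
  moreover have "\<forall>z\<in>carrier R. (\<forall>y\<in>insert x X. z \<otimes> e y = e y \<otimes> z) \<longrightarrow>
    (\<forall>A\<subseteq>insert x X. z \<otimes> F' A = F' A \<otimes> z)"
    by (intro ballI allI impI commF') (assumption | erule (1) bspec)+
  ultimately show ?case
    by (intro exI[of _ F'] conjI)
qed

lemma finsum_eq_single:
  assumes "finite I" "i \<in> I" "f \<in> I \<rightarrow> carrier R" "\<And>j. j \<in> I \<Longrightarrow> j \<noteq> i \<Longrightarrow> f j = \<zero>"
  shows "finsum R f I = f i"
proof -
  have "finsum R f I = (\<Oplus>j\<in>I. if i = j then f j else \<zero>)"
    using assms by (intro finsum_cong') auto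
  then show ?thesis
    using finsum_singleton[of i I f] assms by simp
qed

lemma resolution_transport:
  assumes F: "resolution R X e F" and X: "finite X" and z: "z \<in> carrier R"
    and e: "e \<in> X \<rightarrow> carrier R"
    and \<sigma>: "bij_betw \<sigma> X X" and ze: "\<And>x. x \<in> X \<Longrightarrow> z \<otimes> e x = e (\<sigma> x) \<otimes> z"
    and A: "A \<subseteq> X" and B: "B \<subseteq> X"
  shows "F A \<otimes> (z \<otimes> F B) = (if A = \<sigma> ` B then z \<otimes> F B else \<zero>)"
proof -
  have FC [simp]: "\<And>A. A \<subseteq> X \<Longrightarrow> F A \<in> carrier R"
    and eF: "\<And>A y. A \<subseteq> X \<Longrightarrow> y \<in> X \<Longrightarrow> e y \<otimes> F A = (if y \<in> A then F A else \<zero>)"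
    and Fe: "\<And>A y. A \<subseteq> X \<Longrightarrow> y \<in> X \<Longrightarrow> F A \<otimes> e y = (if y \<in> A then F A else \<zero>)"
    and sumF: "(\<Oplus>A\<in>Pow X. F A) = \<one>"
    using F by (auto simp: resolution_def)
  have \<sigma>X: "\<sigma> ` X = X" and \<sigma>inj: "inj_on \<sigma> X"
    using \<sigma> by (auto simp: bij_betw_def)
  have zero: "F C \<otimes> (z \<otimes> F B) = \<zero>" if C: "C \<subseteq> X" and ne: "C \<noteq> \<sigma> ` B" for C
  proof -
    have "\<exists>x\<in>X. \<not> (\<sigma> x \<in> C \<longleftrightarrow> x \<in> B)"
    proof (rule ccontr)
      assume "\<not> ?thesis"
      then have iff: "\<sigma> x \<in> C \<longleftrightarrow> x \<in> B" if "x \<in> X" for x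
        using that by auto
      have "C = \<sigma> ` B"
      proof (intro equalityI subsetI)
        fix y assume y: "y \<in> C"
        then obtain x where "x \<in> X" "y = \<sigma> x"
          using C \<sigma>X by (metis imageE subsetD)
        then show "y \<in> \<sigma> ` B"
          using y iff by simp
      next
        fix y assume "y \<in> \<sigma> ` B"
        then show "y \<in> C"
          using iff B by auto
      qed
      then show False
        using ne by contradiction
    qed
    then obtain x where x: "x \<in> X" "\<not> (\<sigma> x \<in> C \<longleftrightarrow> x \<in> B)"
      by blast
    have \<sigma>x: "\<sigma> x \<in> X"
      using x \<sigma>X by blast
    have ec: "e x \<in> carrier R" "e (\<sigma> x) \<in> carrier R"
      using e x \<sigma>x by auto
    \<comment> \<open>Evaluate this product in two ways, by the eigenvalue of
      \<open>e (\<sigma> x)\<close> on \<open>F C\<close> and by that of \<open>e x\<close> on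
      \<open>F B\<close>. One of them is 0 and the other is 1.\<close>
    have "F C \<otimes> e (\<sigma> x) \<otimes> (z \<otimes> F B) = F C \<otimes> (e (\<sigma> x) \<otimes> z \<otimes> F B)"
      using ec z B C by (simp add: m_assoc)
    also have "\<dots> = F C \<otimes> (z \<otimes> (e x \<otimes> F B))"
      unfolding ze[OF x(1), symmetric] using ec z B C by (simp add: m_assoc)
    finally have "F C \<otimes> e (\<sigma> x) \<otimes> (z \<otimes> F B) = F C \<otimes> (z \<otimes> (e x \<otimes> F B))" .
    then show ?thesis
      using x eF[OF B x(1)] Fe[OF C \<sigma>x] z B C by (cases "x \<in> B") auto
  qed
  have \<sigma>B: "\<sigma> ` B \<subseteq> X"
    using B \<sigma>X by blast
  have "z \<otimes> F B = (\<Oplus>C\<in>Pow X. F C) \<otimes> (z \<otimes> F B)"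
    using sumF z B by simp
  also have "\<dots> = (\<Oplus>C\<in>Pow X. F C \<otimes> (z \<otimes> F B))"
    using X z B by (intro finsum_ldistr) auto
  also have "\<dots> = F (\<sigma> ` B) \<otimes> (z \<otimes> F B)"
    using X z B \<sigma>B zero by (intro finsum_eq_single) auto
  finally show ?thesis
    using zero[OF A] by auto
qed

end

section \<open>Endomorphism algebras and categories of representations\<close>

lemma linear_mapsD:
  assumes "f \<in> linear_maps V W"
  shows "\<And>v. v \<in> carrier V \<Longrightarrow> f v \<in> carrier W"
    and "\<And>u v. u \<in> carrier V \<Longrightarrow> v \<in> carrier V \<Longrightarrow> f (u \<oplus>\<^bsub>V\<^esub> v) = f u \<oplus>\<^bsub>W\<^esub> f v"
    and "\<And>c v. v \<in> carrier V \<Longrightarrow> f (c \<odot>\<^bsub>V\<^esub> v) = c \<odot>\<^bsub>W\<^esub> f v"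
    and "f \<in> extensional (carrier V)"
  using assms by (auto simp: linear_maps_def LinearCombinations.module_hom_def)

lemma linear_mapsI:
  assumes "\<And>v. v \<in> carrier V \<Longrightarrow> f v \<in> carrier W"
    and "\<And>u v. u \<in> carrier V \<Longrightarrow> v \<in> carrier V \<Longrightarrow> f (u \<oplus>\<^bsub>V\<^esub> v) = f u \<oplus>\<^bsub>W\<^esub> f v"
    and "\<And>c v. v \<in> carrier V \<Longrightarrow> f (c \<odot>\<^bsub>V\<^esub> v) = c \<odot>\<^bsub>W\<^esub> f v"
    and "f \<in> extensional (carrier V)"
  shows "f \<in> linear_maps V W"
  using assms by (auto simp: linear_maps_def LinearCombinations.module_hom_def)

lemma linear_maps_ext:
  assumes "f \<in> linear_maps V W" "g \<in> linear_maps V W'" "\<And>v. v \<in> carrier V \<Longrightarrow> f v = g v"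
  shows "f = g"
  using assms by (intro extensionalityI[of f "carrier V"]) (auto simp: linear_maps_def)

lemma compose_linear_maps:
  assumes f: "f \<in> linear_maps U V" and g: "g \<in> linear_maps V W" and U: "Module.module complex_field U"
  shows "compose (carrier U) g f \<in> linear_maps U W"
proof -
  interpret Module.module complex_field U by (rule U)
  show ?thesis
    using linear_mapsD[OF f] linear_mapsD[OF g] smult_closed
    by (intro linear_mapsI) (simp_all add: compose_eq)
qed

lemma id_linear_maps:
  assumes "Module.module complex_field V"
  shows "(\<lambda>v\<in>carrier V. v) \<in> linear_maps V V"
proof -
  interpret Module.module complex_field V by (rule assms)
  show ?thesis
    using smult_closed by (intro linear_mapsI) simp_all
qed

lemma End_alg_simps:
  "carrier (End_alg V) = linear_maps V V"
  "f \<otimes>\<^bsub>End_alg V\<^esub> g = compose (carrier V) f g"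
  "\<one>\<^bsub>End_alg V\<^esub> = (\<lambda>v\<in>carrier V. v)"
  "\<zero>\<^bsub>End_alg V\<^esub> = (\<lambda>v\<in>carrier V. \<zero>\<^bsub>V\<^esub>)"
  "f \<oplus>\<^bsub>End_alg V\<^esub> g = (\<lambda>v\<in>carrier V. f v \<oplus>\<^bsub>V\<^esub> g v)"
  "c \<odot>\<^bsub>End_alg V\<^esub> f = (\<lambda>v\<in>carrier V. c \<odot>\<^bsub>V\<^esub> f v)"
  by (simp_all add: End_alg_def)

text \<open>The locale \<^locale>\<open>algebra\<close> is restricted to commutative algebras.\<close>

locale assoc_algebra = Module.module complex_field A + ring A for A :: "(complex, 'a) module" (structure) +
  assumes smult_mult: "x \<in> carrier A \<Longrightarrow> y \<in> carrier A \<Longrightarrow> (c \<odot> x) \<otimes> y = c \<odot> (x \<otimes> y)"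
    and mult_smult: "x \<in> carrier A \<Longrightarrow> y \<in> carrier A \<Longrightarrow> x \<otimes> (c \<odot> y) = c \<odot> (x \<otimes> y)"

lemma End_alg_assoc_algebra:
  assumes "Module.module complex_field V"
  shows "assoc_algebra (End_alg V)"
proof -
  interpret Module.module complex_field V by (rule assms)
  note ac = M.a_assoc M.a_comm M.a_lcomm
  note [simp] = linear_mapsD(1-3)
  \<comment> \<open>The module axioms are restated with the arithmetic of the complex numbers in
    place of the operations of the record \<open>complex_field\<close>.\<close>
  have sc [simp]: "c \<odot>\<^bsub>V\<^esub> v \<in> carrier V" if "v \<in> carrier V" for c v
    using that smult_closed by simp
  have sd: "c \<odot>\<^bsub>V\<^esub> (u \<oplus>\<^bsub>V\<^esub> v) = c \<odot>\<^bsub>V\<^esub> u \<oplus>\<^bsub>V\<^esub> c \<odot>\<^bsub>V\<^esub> v" if "u \<in> carrier V" "v \<in> carrier V" for c u v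
    using that smult_r_distr by simp
  have sl: "(c + d) \<odot>\<^bsub>V\<^esub> v = c \<odot>\<^bsub>V\<^esub> v \<oplus>\<^bsub>V\<^esub> d \<odot>\<^bsub>V\<^esub> v" if "v \<in> carrier V" for c d v
    using that smult_l_distr by simp
  have sa: "c \<odot>\<^bsub>V\<^esub> (d \<odot>\<^bsub>V\<^esub> v) = (c * d) \<odot>\<^bsub>V\<^esub> v" if "v \<in> carrier V" for c d v
    using that smult_assoc1 by simp
  have s1: "1 \<odot>\<^bsub>V\<^esub> v = v" if "v \<in> carrier V" for v
    using that smult_one by simp
  have s0: "c \<odot>\<^bsub>V\<^esub> \<zero>\<^bsub>V\<^esub> = \<zero>\<^bsub>V\<^esub>" for c
    by simp
  have zero: "(\<lambda>v\<in>carrier V. \<zero>\<^bsub>V\<^esub>) \<in> linear_maps V V"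
    by (rule linear_mapsI) (simp_all add: s0)
  have add: "(\<lambda>v\<in>carrier V. f v \<oplus>\<^bsub>V\<^esub> g v) \<in> linear_maps V V"
    if "f \<in> linear_maps V V" "g \<in> linear_maps V V" for f g
    using that by (intro linear_mapsI) (simp_all add: ac sd)
  have smult: "(\<lambda>v\<in>carrier V. c \<odot>\<^bsub>V\<^esub> f v) \<in> linear_maps V V" if "f \<in> linear_maps V V" for c f
    using that by (intro linear_mapsI) (simp_all add: sd sa mult.commute)
  have neg: "\<exists>g\<in>linear_maps V V. (\<lambda>v\<in>carrier V. g v \<oplus>\<^bsub>V\<^esub> f v) = (\<lambda>v\<in>carrier V. \<zero>\<^bsub>V\<^esub>)"
    if f: "f \<in> linear_maps V V" for f
  proof (rule bexI)
    show "(\<lambda>v\<in>carrier V. (-1) \<odot>\<^bsub>V\<^esub> f v) \<in> linear_maps V V"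
      by (rule smult[OF f])
    have "(-1) \<odot>\<^bsub>V\<^esub> f v \<oplus>\<^bsub>V\<^esub> f v = \<zero>\<^bsub>V\<^esub>" if "v \<in> carrier V" for v
      using sl[of "f v" "-1" 1] f that s1 smult_l_null[of "f v"] by simp
    then show "(\<lambda>v\<in>carrier V. (\<lambda>v\<in>carrier V. (-1) \<odot>\<^bsub>V\<^esub> f v) v \<oplus>\<^bsub>V\<^esub> f v) = (\<lambda>v\<in>carrier V. \<zero>\<^bsub>V\<^esub>)"
      by (intro restrict_ext) simp
  qed
  note comp = compose_linear_maps[OF _ _ assms]
  have ab: "abelian_group (End_alg V)"
  proof (rule abelian_groupI, unfold End_alg_simps)
    show "\<exists>g\<in>linear_maps V V. (\<lambda>v\<in>carrier V. g v \<oplus>\<^bsub>V\<^esub> f v) = (\<lambda>v\<in>carrier V. \<zero>\<^bsub>V\<^esub>)"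
      if f: "f \<in> linear_maps V V" for f
      using neg[OF f] .
    show "(\<lambda>v\<in>carrier V. (\<lambda>v\<in>carrier V. \<zero>\<^bsub>V\<^esub>) v \<oplus>\<^bsub>V\<^esub> f v) = f" if f: "f \<in> linear_maps V V" for f
      by (rule linear_maps_ext[OF add[OF zero f] f]) (use f in simp)
  qed (auto simp: zero add ac intro!: restrict_ext)
  have mon: "Group.monoid (End_alg V)"
  proof (rule monoidI, unfold End_alg_simps)
    show "compose (carrier V) (compose (carrier V) f g) h = compose (carrier V) f (compose (carrier V) g h)"
      if "f \<in> linear_maps V V" "g \<in> linear_maps V V" "h \<in> linear_maps V V" for f g h
      by (rule compose_assoc[symmetric]) (use that in auto)
    show "compose (carrier V) (\<lambda>v\<in>carrier V. v) f = f" "compose (carrier V) f (\<lambda>v\<in>carrier V. v) = f"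
      if "f \<in> linear_maps V V" for f
      using that by (auto intro!: Id_compose compose_Id linear_mapsD(4))
  qed (auto simp: comp id_linear_maps assms)
  have ring: "ring (End_alg V)"
    by (rule ringI[OF ab mon], unfold End_alg_simps)
      (auto simp: compose_def ac intro!: restrict_ext)
  have mod: "Module.module complex_field (End_alg V)"
  proof (rule moduleI[OF Module.module.axioms(1)[OF assms] ab], unfold End_alg_simps)
    show "(\<lambda>v\<in>carrier V. \<one>\<^bsub>complex_field\<^esub> \<odot>\<^bsub>V\<^esub> f v) = f" if f: "f \<in> linear_maps V V" for f
      by (rule linear_maps_ext[OF smult[OF f] f]) (use f in \<open>simp add: s1\<close>)
  qed (auto simp: smult sd sl sa intro!: restrict_ext)
  show ?thesis
    by (rule assoc_algebra.intro[OF mod ring], rule assoc_algebra_axioms.intro, unfold End_alg_simps)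
      (auto simp: compose_def intro!: restrict_ext)
qed

lemma (in assoc_algebra) alg_homsD:
  assumes "\<rho> \<in> alg_homs B A"
  shows "\<And>a. a \<in> carrier B \<Longrightarrow> \<rho> a \<in> carrier A"
    and "\<And>a b. a \<in> carrier B \<Longrightarrow> b \<in> carrier B \<Longrightarrow> \<rho> (a \<oplus>\<^bsub>B\<^esub> b) = \<rho> a \<oplus> \<rho> b"
    and "\<And>a b. a \<in> carrier B \<Longrightarrow> b \<in> carrier B \<Longrightarrow> \<rho> (a \<otimes>\<^bsub>B\<^esub> b) = \<rho> a \<otimes> \<rho> b"
    and "\<And>c a. a \<in> carrier B \<Longrightarrow> \<rho> (c \<odot>\<^bsub>B\<^esub> a) = c \<odot> \<rho> a"
    and "\<rho> \<one>\<^bsub>B\<^esub> = \<one>"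
    and "\<rho> \<in> extensional (carrier B)"
  using assms by (auto simp: alg_homs_def Ring.ring_hom_def LinearCombinations.module_hom_def)

lemma fin_dim_vs_module: "fin_dim_vs V \<Longrightarrow> Module.module complex_field V"
  by (simp add: fin_dim_vs_def vectorspace_def)

lemma fin_dim_vs_End_alg: "fin_dim_vs V \<Longrightarrow> assoc_algebra (End_alg V)"
  by (intro End_alg_assoc_algebra fin_dim_vs_module)

section \<open>Categories of spaces with operators\<close>

text \<open>Stated for any class of objects acting by linear maps, so that both categories of the
  theorem are instances. Composites intertwine by associativity.\<close>

lemma is_category_rep_category:
  fixes obs :: "((complex, 'v) module \<times> ('x \<Rightarrow> 'v \<Rightarrow> 'v)) set"
  assumes "\<And>V \<rho>. (V, \<rho>) \<in> obs \<Longrightarrow> fin_dim_vs V \<and> (\<forall>x\<in>X. \<rho> x \<in> linear_maps V V)"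
  shows "is_category (rep_category X obs)"
proof -
  have mod: "Module.module complex_field V" if "(V, \<rho>) \<in> obs" for V \<rho>
    using assms[OF that] fin_dim_vs_module by blast
  have assoc: "compose (carrier U) h (compose (carrier U) g f) = compose (carrier U) (compose (carrier V) h g) f"
    if "f \<in> linear_maps U V" for U V :: "(complex, 'v) module" and f g h
    by (rule compose_assoc) (use linear_mapsD(1)[OF that] in auto)
  have ids: "compose (carrier U) f (\<lambda>v\<in>carrier U. v) = f" "compose (carrier U) (\<lambda>v\<in>carrier V. v) f = f"
    if "f \<in> linear_maps U V" for U V :: "(complex, 'v) module" and f
    using linear_mapsD(1,4)[OF that] by (auto intro!: Id_compose compose_Id)
  have ids_obs: "compose (carrier V) (\<rho> x) (\<lambda>v\<in>carrier V. v) = \<rho> x"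
    "compose (carrier V) (\<lambda>v\<in>carrier V. v) (\<rho> x) = \<rho> x" if "(V, \<rho>) \<in> obs" "x \<in> X" for V \<rho> x
    using assms that ids by blast+
  have comp: "compose (carrier U) (compose (carrier U) g f) (\<rho> x) =
      compose (carrier U) (\<tau> x) (compose (carrier U) g f)"
    if "(U, \<rho>) \<in> obs" "(V, \<sigma>) \<in> obs" "x \<in> X"
      and f: "f \<in> linear_maps U V" "compose (carrier U) f (\<rho> x) = compose (carrier U) (\<sigma> x) f"
      and g: "g \<in> linear_maps V W" "compose (carrier V) g (\<sigma> x) = compose (carrier V) (\<tau> x) g"
    for U V W \<rho> \<sigma> \<tau> x f g
  proof -
    have r: "\<rho> x \<in> linear_maps U U"
      using assms that by blast
    have "compose (carrier U) (compose (carrier U) g f) (\<rho> x) = compose (carrier U) g (compose (carrier U) f (\<rho> x))"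
      by (rule assoc[OF r, symmetric])
    also have "\<dots> = compose (carrier U) (compose (carrier V) g (\<sigma> x)) f"
      by (simp add: f(2) assoc[OF f(1)])
    also have "\<dots> = compose (carrier U) (\<tau> x) (compose (carrier U) g f)"
      by (simp add: g(2) assoc[OF f(1)])
    finally show ?thesis .
  qed
  show ?thesis
    unfolding is_category_def rep_category_def
    by (auto simp: ids ids_obs assoc compose_linear_maps id_linear_maps mod assms comp)
qed

text \<open>Identities and composites depend only on the underlying spaces. A functor that changes
  neither the spaces nor the linear maps therefore only has to send objects to objects and
  intertwiners to intertwiners.\<close>

lemma is_functor_rep_category:
  assumes "is_category (rep_category X obs)" "is_category (rep_category Y obs')"
    and Fo: "\<And>V \<rho>. (V, \<rho>) \<in> obs \<Longrightarrow> (V, \<Phi> V \<rho>) \<in> obs'"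
    and "\<And>V \<rho> W \<sigma> f y. (V, \<rho>) \<in> obs \<Longrightarrow> (W, \<sigma>) \<in> obs \<Longrightarrow> f \<in> linear_maps V W \<Longrightarrow>
      (\<And>x. x \<in> X \<Longrightarrow> compose (carrier V) f (\<rho> x) = compose (carrier V) (\<sigma> x) f) \<Longrightarrow> y \<in> Y \<Longrightarrow>
      compose (carrier V) f (\<Phi> V \<rho> y) = compose (carrier V) (\<Phi> W \<sigma> y) f"
  shows "is_functor (rep_category X obs) (rep_category Y obs') (\<lambda>(V, \<rho>). (V, \<Phi> V \<rho>)) (\<lambda>_ _ f. f)"
  using assms(1,2) unfolding is_functor_def
  by (auto simp: rep_category_def Fo assms(4))

section \<open>The groupoid algebra\<close>

text \<open>This is the element \<Sum>(A, g) with A ranging over S. Basis elements, the unit and all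
  \<open>mu_p G H g\<close> have this form, and by \<open>slice_mult\<close> the form is stable
  under products.\<close>

definition slice :: "'x set \<Rightarrow> 'y \<Rightarrow> 'x \<times> 'y \<Rightarrow> complex" where
  "slice S g = (\<lambda>(A, k). if A \<in> S \<and> k = g then 1 else 0)"

lemma slice_eq_sum: "finite S \<Longrightarrow> slice S g z = (\<Sum>A\<in>S. basis_vec (A, g) z)"
proof (cases z)
  case (Pair B k)
  assume "finite S"
  have "(\<Sum>A\<in>S. basis_vec (A, g) z) = (\<Sum>A\<in>S. if B = A then (if k = g then 1 else 0) else 0)"
    by (intro sum.cong) (auto simp: basis_vec_def Pair)
  then show ?thesis
    using \<open>finite S\<close> by (simp add: slice_def Pair)
qed

lemma basis_vec_eq_slice: "basis_vec (A, g) = slice {A} g"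
  by (auto simp: slice_def basis_vec_def)

locale finite_group_with_subgroup = group G + subgroup H G
  for G :: "('g, 'b) monoid_scheme" (structure) and H +
  assumes finite_carrier: "finite (carrier G)"
begin

section \<open>Unions of cosets and elements of the groupoid\<close>

abbreviation "\<P> \<equiv> coset_unions G H"

text \<open>For g in the group this indexes the groupoid elements with second component g, which are
  the summands of \<open>mu_p G H g\<close>.\<close>

definition \<P>\<^sub>i :: "'g \<Rightarrow> 'g set set" where
  "\<P>\<^sub>i g = {A \<in> \<P>. inv g \<in> A}"

text \<open>Being a union of left cosets amounts to stability under right multiplication by H. In
  this form membership can be checked elementwise.\<close>

lemma coset_unions_iff:
  "A \<in> \<P> \<longleftrightarrow> A \<subseteq> carrier G \<and> H \<subseteq> A \<and> (\<forall>x\<in>A. \<forall>h\<in>H. x \<otimes> h \<in> A)"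
proof
  assume "A \<in> \<P>"
  then obtain S where A: "A \<subseteq> carrier G" "H \<subseteq> A" and S: "S \<subseteq> lcosets H" "A = \<Union>S"
    by (auto simp: coset_unions_def)
  have "x \<otimes> h \<in> A" if "x \<in> A" and h: "h \<in> H" for x h
  proof -
    obtain C a where C: "C \<in> S" "x \<in> C" "a \<in> carrier G" "C = a <# H"
      using S \<open>x \<in> A\<close> by (auto simp: LCOSETS_def)
    then obtain k where "k \<in> H" "x = a \<otimes> k"
      by (auto simp: l_coset_def)
    then have "x \<otimes> h = a \<otimes> (k \<otimes> h)" "k \<otimes> h \<in> H"
      using C h by (auto simp: m_assoc)
    then show ?thesis
      using C S by (auto simp: l_coset_def)
  qed
  then show "A \<subseteq> carrier G \<and> H \<subseteq> A \<and> (\<forall>x\<in>A. \<forall>h\<in>H. x \<otimes> h \<in> A)"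
    using A by blast
next
  assume A: "A \<subseteq> carrier G \<and> H \<subseteq> A \<and> (\<forall>x\<in>A. \<forall>h\<in>H. x \<otimes> h \<in> A)"
  \<comment> \<open>A stable set is the union of the cosets of its own elements.\<close>
  have "A = \<Union>((\<lambda>x. x <# H) ` A)"
  proof (intro equalityI subsetI)
    fix x assume "x \<in> A"
    then show "x \<in> \<Union>((\<lambda>x. x <# H) ` A)"
      using A lcos_self[OF _ subgroup_axioms] by (intro UN_I) auto
  qed (use A in \<open>auto simp: l_coset_def\<close>)
  moreover have "(\<lambda>x. x <# H) ` A \<subseteq> lcosets H"
    using A by (auto simp: LCOSETS_def)
  ultimately show "A \<in> \<P>"
    using A unfolding coset_unions_def by blast
qed

lemma coset_unions_subset: "B \<in> \<P> \<Longrightarrow> B \<subseteq> carrier G"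
  by (simp add: coset_unions_iff)

lemma finite_coset_unions [simp]: "finite \<P>"
  by (rule finite_subset[of _ "Pow (carrier G)"]) (auto simp: coset_unions_iff finite_carrier)

lemma finite_\<P>\<^sub>i [simp]: "finite (\<P>\<^sub>i g)"
  by (simp add: \<P>\<^sub>i_def)

lemma Gamma_iff: "(A, g) \<in> Gamma G H \<longleftrightarrow> g \<in> carrier G \<and> A \<in> \<P>\<^sub>i g"
  by (auto simp: Gamma_def \<P>\<^sub>i_def)

lemma finite_Gamma [simp]: "finite (Gamma G H)"
  by (rule finite_subset[of _ "\<P> \<times> carrier G"]) (auto simp: Gamma_def finite_carrier)

lemma l_coset_iff:
  assumes "h \<in> carrier G" "B \<subseteq> carrier G" "x \<in> carrier G"
  shows "x \<in> h <# B \<longleftrightarrow> inv h \<otimes> x \<in> B"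
proof
  assume "x \<in> h <# B"
  then show "inv h \<otimes> x \<in> B"
    using assms by (auto simp: l_coset_def inv_solve_left' m_assoc[symmetric] subset_iff)
next
  assume "inv h \<otimes> x \<in> B"
  then show "x \<in> h <# B"
    using assms by (auto simp: l_coset_def m_assoc[symmetric] intro!: bexI[of _ "inv h \<otimes> x"])
qed

text \<open>Left translation preserves right stability under H. From \<open>inv h \<in> B\<close>
  stability gives \<open>inv h \<otimes> k \<in> B\<close> for all k in H, which says that the
  translate contains H.\<close>

lemma l_coset_in_coset_unions:
  assumes h: "h \<in> carrier G" and B: "B \<in> \<P>\<^sub>i h"
  shows "h <# B \<in> \<P>"
proof -
  have BG: "B \<subseteq> carrier G" and BH: "\<And>x k. x \<in> B \<Longrightarrow> k \<in> H \<Longrightarrow> x \<otimes> k \<in> B" and hB: "inv h \<in> B"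
    using B by (auto simp: \<P>\<^sub>i_def coset_unions_iff)
  have "H \<subseteq> h <# B"
    using h BG BH[OF hB] by (auto simp: l_coset_iff)
  moreover have "x \<otimes> k \<in> h <# B" if "x \<in> h <# B" "k \<in> H" for x k
  proof -
    have x: "x \<in> carrier G"
      using that(1) h BG by (auto simp: l_coset_def)
    then show ?thesis
      using that h BG BH[of "inv h \<otimes> x" k] by (simp add: l_coset_iff m_assoc)
  qed
  ultimately show ?thesis
    using h BG by (auto simp: coset_unions_iff l_coset_def)
qed

section \<open>Products in the groupoid algebra and the identities of \<open>mu_p\<close>\<close>

lemma Gamma_alg_simps:
  "a \<in> carrier (Gamma_alg G H) \<longleftrightarrow> (\<forall>x. x \<notin> Gamma G H \<longrightarrow> a x = 0)"
  "a \<otimes>\<^bsub>Gamma_alg G H\<^esub> b = (\<lambda>z. \<Sum>x\<in>Gamma G H. \<Sum>y\<in>Gamma G H.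
     a x * b y * (case Gamma_mult G x y of None \<Rightarrow> 0 | Some w \<Rightarrow> basis_vec w z))"
  "\<zero>\<^bsub>Gamma_alg G H\<^esub> = (\<lambda>z. 0)"
  "a \<oplus>\<^bsub>Gamma_alg G H\<^esub> b = (\<lambda>z. a z + b z)"
  "c \<odot>\<^bsub>Gamma_alg G H\<^esub> a = (\<lambda>z. c * a z)"
  by (simp_all add: Gamma_alg_def)

lemma Gamma_alg_one: "\<one>\<^bsub>Gamma_alg G H\<^esub> = slice \<P> \<one>"
  by (auto simp: Gamma_alg_def slice_eq_sum)

lemma mu_p_eq_slice: "mu_p G H g = slice (\<P>\<^sub>i g) g"
  by (rule ext) (simp add: mu_p_def slice_eq_sum \<P>\<^sub>i_def)

lemma slice_closed:
  "g \<in> carrier G \<Longrightarrow> S \<subseteq> \<P>\<^sub>i g \<Longrightarrow> slice S g \<in> carrier (Gamma_alg G H)"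
  by (auto simp: Gamma_alg_simps slice_def Gamma_iff)

lemma \<P>\<^sub>i_one [simp]: "\<P>\<^sub>i \<one> = \<P>"
  by (auto simp: \<P>\<^sub>i_def coset_unions_iff dest: subsetD[OF _ subgroup.one_closed[OF subgroup_axioms]])

lemma mu_p_closed: "g \<in> carrier G \<Longrightarrow> mu_p G H g \<in> carrier (Gamma_alg G H)"
  by (simp add: mu_p_eq_slice slice_closed)

lemma mu_p_one: "mu_p G H \<one> = \<one>\<^bsub>Gamma_alg G H\<^esub>"
  by (simp add: mu_p_eq_slice Gamma_alg_one)

lemma sum_slice:
  assumes "g \<in> carrier G" "S \<subseteq> \<P>\<^sub>i g"
  shows "(\<Sum>x\<in>Gamma G H. slice S g x * f x) = (\<Sum>A\<in>S. f (A, g))"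
proof -
  have "(\<Sum>A\<in>S. f (A, g)) = (\<Sum>x\<in>(\<lambda>A. (A, g)) ` S. f x)"
    by (subst sum.reindex) (auto simp: inj_on_def)
  also have "\<dots> = (\<Sum>x\<in>Gamma G H. slice S g x * f x)"
    using assms by (intro sum.mono_neutral_cong_left) (auto simp: Gamma_iff slice_def)
  finally show ?thesis ..
qed

text \<open>Each B in T is composable with exactly one A, namely \<open>h <# B\<close>, so the
  double sum has at most one term for each B.\<close>

lemma slice_mult:
  assumes "g \<in> carrier G" "S \<subseteq> \<P>\<^sub>i g" "h \<in> carrier G" "T \<subseteq> \<P>\<^sub>i h"
  shows "slice S g \<otimes>\<^bsub>Gamma_alg G H\<^esub> slice T h = slice {B \<in> T. h <# B \<in> S} (g \<otimes> h)"
proof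
  fix z
  have S: "finite S" and T: "finite T"
    using assms finite_subset by (blast intro: finite_\<P>\<^sub>i)+
  have "(slice S g \<otimes>\<^bsub>Gamma_alg G H\<^esub> slice T h) z =
    (\<Sum>A\<in>S. \<Sum>B\<in>T. if A = h <# B then basis_vec (B, g \<otimes> h) z else 0)"
    using sum_slice[OF assms(1,2)] sum_slice[OF assms(3,4)]
    by (simp add: Gamma_alg_simps mult.assoc if_distrib cong: if_cong flip: sum_distrib_left)
  also have "\<dots> = (\<Sum>B\<in>T. if h <# B \<in> S then basis_vec (B, g \<otimes> h) z else 0)"
    by (subst sum.swap) (simp add: S)
  also have "\<dots> = slice {B \<in> T. h <# B \<in> S} (g \<otimes> h) z"
    using T by (simp add: slice_eq_sum sum.inter_filter)
  finally show "(slice S g \<otimes>\<^bsub>Gamma_alg G H\<^esub> slice T h) z = slice {B \<in> T. h <# B \<in> S} (g \<otimes> h) z" .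
qed

text \<open>Since \<open>inv (g \<otimes> h) = inv h \<otimes> inv g\<close>, the condition
  \<open>inv g \<in> h <# B\<close> translates to
  \<open>inv (g \<otimes> h) \<in> B\<close>.\<close>

lemma \<P>\<^sub>i_mult:
  assumes "g \<in> carrier G" "h \<in> carrier G"
  shows "{B \<in> \<P>\<^sub>i h. h <# B \<in> \<P>\<^sub>i g} = \<P>\<^sub>i h \<inter> \<P>\<^sub>i (g \<otimes> h)"
proof -
  have "h <# B \<in> \<P>\<^sub>i g \<longleftrightarrow> inv (g \<otimes> h) \<in> B" if "B \<in> \<P>\<^sub>i h" for B
  proof -
    have "B \<subseteq> carrier G"
      using that by (auto simp: \<P>\<^sub>i_def coset_unions_iff)
    then show ?thesis
      using assms l_coset_in_coset_unions[OF assms(2) that]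
      by (simp add: \<P>\<^sub>i_def l_coset_iff inv_mult_group)
  qed
  then show ?thesis
    by (auto simp: \<P>\<^sub>i_def)
qed

text \<open>Multiplicativity fails only by the condition \<open>inv h \<in> B\<close>: the product
  keeps those summands of \<open>mu_p G H (g \<otimes> h)\<close> that satisfy it.\<close>

lemma mu_p_mult:
  assumes "g \<in> carrier G" "h \<in> carrier G"
  shows "mu_p G H g \<otimes>\<^bsub>Gamma_alg G H\<^esub> mu_p G H h = slice (\<P>\<^sub>i h \<inter> \<P>\<^sub>i (g \<otimes> h)) (g \<otimes> h)"
  using assms by (simp add: mu_p_eq_slice slice_mult \<P>\<^sub>i_mult)

text \<open>The left factor has the shape produced by \<open>mu_p_mult\<close>, so this evaluates
  triple products.\<close>

lemma slice_mult_mu_p: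
  assumes "g \<in> carrier G" "k \<in> carrier G" "h \<in> carrier G"
  shows "slice (\<P>\<^sub>i g \<inter> \<P>\<^sub>i k) g \<otimes>\<^bsub>Gamma_alg G H\<^esub> mu_p G H h =
    slice (\<P>\<^sub>i h \<inter> \<P>\<^sub>i (g \<otimes> h) \<inter> \<P>\<^sub>i (k \<otimes> h)) (g \<otimes> h)"
proof -
  have "{B \<in> \<P>\<^sub>i h. h <# B \<in> \<P>\<^sub>i g \<inter> \<P>\<^sub>i k} = \<P>\<^sub>i h \<inter> \<P>\<^sub>i (g \<otimes> h) \<inter> \<P>\<^sub>i (k \<otimes> h)"
    using \<P>\<^sub>i_mult[of g h] \<P>\<^sub>i_mult[of k h] assms by auto
  then show ?thesis
    using assms by (simp add: mu_p_eq_slice slice_mult)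
qed

lemma \<P>\<^sub>i_subgroup: "h \<in> H \<Longrightarrow> \<P>\<^sub>i h = \<P>"
  by (auto simp: \<P>\<^sub>i_def coset_unions_iff dest: subsetD[OF _ subgroup.m_inv_closed[OF subgroup_axioms]])

text \<open>Both sides are the slice at h over the sets containing \<open>inv h\<close> and
  \<open>inv (g \<otimes> h)\<close>. The condition at the neutral element is vacuous because every
  set in \<open>\<P>\<close> contains H.\<close>

lemma mu_p_left:
  assumes "g \<in> carrier G" "h \<in> carrier G"
  shows "mu_p G H (inv g) \<otimes>\<^bsub>Gamma_alg G H\<^esub> mu_p G H (g \<otimes> h) =
    mu_p G H (inv g) \<otimes>\<^bsub>Gamma_alg G H\<^esub> mu_p G H g \<otimes>\<^bsub>Gamma_alg G H\<^esub> mu_p G H h"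
proof -
  have "\<P>\<^sub>i h \<subseteq> \<P>"
    by (auto simp: \<P>\<^sub>i_def)
  then show ?thesis
    using assms slice_mult_mu_p[of \<one> g h]
    by (simp add: mu_p_mult Int_commute Int_absorb1 flip: m_assoc)
qed

text \<open>Both sides are the slice at g over the sets containing h and
  \<open>inv g\<close>.\<close>

lemma mu_p_right:
  assumes "g \<in> carrier G" "h \<in> carrier G"
  shows "mu_p G H (g \<otimes> h) \<otimes>\<^bsub>Gamma_alg G H\<^esub> mu_p G H (inv h) =
    mu_p G H g \<otimes>\<^bsub>Gamma_alg G H\<^esub> mu_p G H h \<otimes>\<^bsub>Gamma_alg G H\<^esub> mu_p G H (inv h)"
proof -
  have "\<P>\<^sub>i (inv h) \<subseteq> \<P>"
    by (auto simp: \<P>\<^sub>i_def)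
  then have *: "\<P>\<^sub>i (inv h) \<inter> \<P> \<inter> \<P>\<^sub>i g = \<P>\<^sub>i (inv h) \<inter> \<P>\<^sub>i g"
    by blast
  show ?thesis
    using assms slice_mult_mu_p[of "g \<otimes> h" h "inv h"]
    by (simp add: mu_p_mult Int_ac m_assoc *[simplified Int_ac])
qed

lemma Gamma_alg_add_closed:
  "a \<in> carrier (Gamma_alg G H) \<Longrightarrow> b \<in> carrier (Gamma_alg G H) \<Longrightarrow>
    a \<oplus>\<^bsub>Gamma_alg G H\<^esub> b \<in> carrier (Gamma_alg G H)"
  by (simp add: Gamma_alg_simps)

lemma Gamma_alg_smult_closed:
  "a \<in> carrier (Gamma_alg G H) \<Longrightarrow> c \<odot>\<^bsub>Gamma_alg G H\<^esub> a \<in> carrier (Gamma_alg G H)"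
  by (simp add: Gamma_alg_simps)

text \<open>A defined product of two groupoid elements lies in the groupoid again by
  \<open>\<P>\<^sub>i_mult\<close>, so every term vanishes outside it.\<close>

lemma Gamma_alg_mult_closed:
  "a \<otimes>\<^bsub>Gamma_alg G H\<^esub> b \<in> carrier (Gamma_alg G H)"
proof -
  have "(case Gamma_mult G x y of None \<Rightarrow> 0 | Some w \<Rightarrow> basis_vec w z) = 0"
    if "x \<in> Gamma G H" "y \<in> Gamma G H" "z \<notin> Gamma G H" for x y z
  proof (cases x; cases y)
    fix C g B h assume xy: "x = (C, g)" "y = (B, h)"
    show ?thesis
      using \<P>\<^sub>i_mult[of g h] that by (auto simp: xy Gamma_iff basis_vec_def)
  qed
  then show ?thesis
    unfolding Gamma_alg_simps by (intro allI impI sum.neutral ballI) simp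
qed

lemma Gamma_alg_bilinear:
  shows "(a \<oplus>\<^bsub>Gamma_alg G H\<^esub> a') \<otimes>\<^bsub>Gamma_alg G H\<^esub> b =
      a \<otimes>\<^bsub>Gamma_alg G H\<^esub> b \<oplus>\<^bsub>Gamma_alg G H\<^esub> a' \<otimes>\<^bsub>Gamma_alg G H\<^esub> b"
    and "b \<otimes>\<^bsub>Gamma_alg G H\<^esub> (a \<oplus>\<^bsub>Gamma_alg G H\<^esub> a') =
      b \<otimes>\<^bsub>Gamma_alg G H\<^esub> a \<oplus>\<^bsub>Gamma_alg G H\<^esub> b \<otimes>\<^bsub>Gamma_alg G H\<^esub> a'"
    and "(c \<odot>\<^bsub>Gamma_alg G H\<^esub> a) \<otimes>\<^bsub>Gamma_alg G H\<^esub> b = c \<odot>\<^bsub>Gamma_alg G H\<^esub> (a \<otimes>\<^bsub>Gamma_alg G H\<^esub> b)"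
    and "b \<otimes>\<^bsub>Gamma_alg G H\<^esub> (c \<odot>\<^bsub>Gamma_alg G H\<^esub> a) = c \<odot>\<^bsub>Gamma_alg G H\<^esub> (b \<otimes>\<^bsub>Gamma_alg G H\<^esub> a)"
    and "\<zero>\<^bsub>Gamma_alg G H\<^esub> \<otimes>\<^bsub>Gamma_alg G H\<^esub> b = \<zero>\<^bsub>Gamma_alg G H\<^esub>"
    and "b \<otimes>\<^bsub>Gamma_alg G H\<^esub> \<zero>\<^bsub>Gamma_alg G H\<^esub> = \<zero>\<^bsub>Gamma_alg G H\<^esub>"
  by (simp_all add: Gamma_alg_simps sum_distrib_left sum_distrib_right sum.distrib algebra_simps)

section \<open>Induction over the basis and over the generators \<open>mu_p\<close>\<close>

lemma Gamma_alg_induct [consumes 1, case_names basis zero add smult]: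
  assumes "a \<in> carrier (Gamma_alg G H)"
    and basis: "\<And>A g. (A, g) \<in> Gamma G H \<Longrightarrow> P (slice {A} g)"
    and zero: "P \<zero>\<^bsub>Gamma_alg G H\<^esub>"
    and add: "\<And>a b. a \<in> carrier (Gamma_alg G H) \<Longrightarrow> b \<in> carrier (Gamma_alg G H) \<Longrightarrow> P a \<Longrightarrow> P b \<Longrightarrow>
      P (a \<oplus>\<^bsub>Gamma_alg G H\<^esub> b)"
    and smult: "\<And>c a. a \<in> carrier (Gamma_alg G H) \<Longrightarrow> P a \<Longrightarrow> P (c \<odot>\<^bsub>Gamma_alg G H\<^esub> a)"
  shows "P a"
proof -
  \<comment> \<open>Membership in the carrier is part of the claim because \<open>add\<close>
    assumes it of both summands.\<close>
  have *: "P (\<lambda>z. \<Sum>x\<in>X. a x * basis_vec x z) \<and>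
    (\<lambda>z. \<Sum>x\<in>X. a x * basis_vec x z) \<in> carrier (Gamma_alg G H)"
    if "finite X" "X \<subseteq> Gamma G H" for X
    using that
  proof (induction X rule: finite_induct)
    case empty
    then show ?case
      using zero by (simp add: Gamma_alg_simps)
  next
    case (insert x X)
    have "P (slice {fst x} (snd x))" "slice {fst x} (snd x) \<in> carrier (Gamma_alg G H)"
      using insert.prems basis[of "fst x" "snd x"]
      by (cases x; auto simp: Gamma_iff intro!: slice_closed)+
    then have "P (\<lambda>z. a x * basis_vec x z)" "(\<lambda>z. a x * basis_vec x z) \<in> carrier (Gamma_alg G H)"
      using smult[of "slice {fst x} (snd x)" "a x"] basis_vec_eq_slice[of "fst x" "snd x"]
      by (auto simp: Gamma_alg_simps)
    then show ?case
      using insert add[of "\<lambda>z. a x * basis_vec x z" "\<lambda>z. \<Sum>x\<in>X. a x * basis_vec x z"]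
      by (simp add: Gamma_alg_simps)
  qed
  have expand: "(\<lambda>z. \<Sum>x\<in>Gamma G H. a x * basis_vec x z) = a"
  proof
    fix z
    have "(\<Sum>x\<in>Gamma G H. a x * basis_vec x z) = (\<Sum>x\<in>Gamma G H. if z = x then a x else 0)"
      by (intro sum.cong) (auto simp: basis_vec_def)
    then show "(\<Sum>x\<in>Gamma G H. a x * basis_vec x z) = a z"
      using assms(1) by (cases z) (simp add: Gamma_alg_simps)
  qed
  then show ?thesis
    using *[OF finite_Gamma order_refl] by (simp only: expand)
qed

text \<open>The idempotents \<open>\<mu>\<^sub>p x \<mu>\<^sub>p x\<^sup>-\<^sup>1 = \<Sum>A\<ni>x. (A, 1)\<close> separate the objects of the groupoid, so their Boolean
  combinations include every \<open>(A, 1)\<close>.\<close>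

lemma Gamma_alg_generated [consumes 1, case_names mu_p add smult mult]:
  assumes "a \<in> carrier (Gamma_alg G H)"
    and mu: "\<And>g. g \<in> carrier G \<Longrightarrow> P (mu_p G H g)"
    and add: "\<And>a b. a \<in> carrier (Gamma_alg G H) \<Longrightarrow> b \<in> carrier (Gamma_alg G H) \<Longrightarrow> P a \<Longrightarrow> P b \<Longrightarrow>
      P (a \<oplus>\<^bsub>Gamma_alg G H\<^esub> b)"
    and smult: "\<And>c a. a \<in> carrier (Gamma_alg G H) \<Longrightarrow> P a \<Longrightarrow> P (c \<odot>\<^bsub>Gamma_alg G H\<^esub> a)"
    and mult: "\<And>a b. a \<in> carrier (Gamma_alg G H) \<Longrightarrow> b \<in> carrier (Gamma_alg G H) \<Longrightarrow> P a \<Longrightarrow> P b \<Longrightarrow>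
      P (a \<otimes>\<^bsub>Gamma_alg G H\<^esub> b)"
  shows "P a"
proof -
  have closed: "slice S \<one> \<in> carrier (Gamma_alg G H)" if "S \<subseteq> \<P>" for S
    using slice_closed[of \<one> S] that by simp
  have P1: "P (slice \<P> \<one>)"
    using mu[of \<one>] by (simp add: mu_p_eq_slice)
  have idem: "P (slice {A \<in> \<P>. x \<in> A} \<one>)" if x: "x \<in> carrier G" for x
  proof -
    have "P (mu_p G H x \<otimes>\<^bsub>Gamma_alg G H\<^esub> mu_p G H (inv x))"
      using x by (intro mult mu mu_p_closed) auto
    moreover have "\<P>\<^sub>i (inv x) \<inter> \<P> = {A \<in> \<P>. x \<in> A}"
      using x by (auto simp: \<P>\<^sub>i_def)
    ultimately show ?thesis
      using x by (simp add: mu_p_mult)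
  qed
  have inter: "P (slice (S \<inter> T) \<one>)" if "S \<subseteq> \<P>" "T \<subseteq> \<P>" "P (slice S \<one>)" "P (slice T \<one>)" for S T
  proof -
    have "\<one> <# B = B" if "B \<in> T" for B
    proof (rule lcos_mult_one)
      show "B \<subseteq> carrier G"
        using that \<open>T \<subseteq> \<P>\<close> coset_unions_iff by blast
    qed
    then have "{B \<in> T. \<one> <# B \<in> S} = S \<inter> T"
      by auto
    then show ?thesis
      using mult[of "slice S \<one>" "slice T \<one>"] slice_mult[of \<one> S \<one> T] that closed by simp
  qed
  have compl: "P (slice (\<P> - S) \<one>)" if "S \<subseteq> \<P>" "P (slice S \<one>)" for S
  proof -
    have "slice (\<P> - S) \<one> = slice \<P> \<one> \<oplus>\<^bsub>Gamma_alg G H\<^esub> (-1) \<odot>\<^bsub>Gamma_alg G H\<^esub> slice S \<one>"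
      using that(1) by (auto simp: Gamma_alg_simps slice_def fun_eq_iff)
    moreover have "(-1) \<odot>\<^bsub>Gamma_alg G H\<^esub> slice S \<one> \<in> carrier (Gamma_alg G H)"
      using closed[OF that(1)] by (simp add: Gamma_alg_simps)
    ultimately show ?thesis
      using add smult P1 closed that by simp
  qed
  \<comment> \<open>Each further point of X fixes membership of one more group element; for X the
    whole group only A is left.\<close>
  have sep: "P (slice {B \<in> \<P>. B \<inter> X = A \<inter> X} \<one>)" if "finite X" "X \<subseteq> carrier G" for A X
    using that
  proof (induction X rule: finite_induct)
    case empty
    then show ?case
      using P1 by simp
  next
    case (insert x X)
    define T where "T = (if x \<in> A then {B \<in> \<P>. x \<in> B} else \<P> - {B \<in> \<P>. x \<in> B})"
    have "P (slice T \<one>)"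
      using idem[of x] compl[of "{B \<in> \<P>. x \<in> B}"] insert.prems by (simp add: T_def)
    then have "P (slice ({B \<in> \<P>. B \<inter> X = A \<inter> X} \<inter> T) \<one>)"
      using insert by (intro inter) (auto simp: T_def)
    also have "{B \<in> \<P>. B \<inter> X = A \<inter> X} \<inter> T = {B \<in> \<P>. B \<inter> insert x X = A \<inter> insert x X}"
      by (auto simp: T_def set_eq_iff)
    finally show ?case .
  qed
  have single: "P (slice {A} \<one>)" if "A \<in> \<P>" for A
  proof -
    have "{B \<in> \<P>. B \<inter> carrier G = A \<inter> carrier G} = {A}"
      using that by (auto simp: coset_unions_iff Int_absorb2)
    then show ?thesis
      using sep[OF finite_carrier, of A] by simp
  qed
  have basis: "P (slice {A} g)" if "(A, g) \<in> Gamma G H" for A g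
  proof -
    have A: "A \<in> \<P>" "A \<in> \<P>\<^sub>i g" "g \<in> carrier G"
      using that by (auto simp: Gamma_iff \<P>\<^sub>i_def)
    have "\<one> <# A = A"
      using A by (intro lcos_mult_one) (auto simp: coset_unions_iff)
    \<comment> \<open>Right multiplication by the idempotent (A, 1) selects the summand (A, g) of
      \<open>mu_p G H g\<close>.\<close>
    then have "slice {A} g = mu_p G H g \<otimes>\<^bsub>Gamma_alg G H\<^esub> slice {A} \<one>"
      using A slice_mult[of g "\<P>\<^sub>i g" \<one> "{A}"] by (simp add: mu_p_eq_slice conj_commute cong: conj_cong)
    then show ?thesis
      using A mult single mu closed mu_p_closed by simp
  qed
  have zero: "P \<zero>\<^bsub>Gamma_alg G H\<^esub>"
    using smult[OF closed P1, of 0] by (simp add: Gamma_alg_simps)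
  show ?thesis
    using assms(1) by (induction rule: Gamma_alg_induct) (auto intro: basis zero add smult)
qed

end

section \<open>The algebra homomorphism of a partial representation\<close>

text \<open>The purely multiplicative part of the definition of an \<open>H\<close>-global partial representation,
  for maps into an arbitrary algebra.\<close>

locale partial_hom = finite_group_with_subgroup G H + A: assoc_algebra A
  for G :: "('g, 'b) monoid_scheme" (structure) and H and A :: "(complex, 'a) module" +
  fixes \<pi> :: "'g \<Rightarrow> 'a"
  assumes pi_closed [simp]: "g \<in> carrier G \<Longrightarrow> \<pi> g \<in> carrier A"
    and pi_one: "\<pi> \<one> = \<one>\<^bsub>A\<^esub>"
    and pi_left: "g \<in> carrier G \<Longrightarrow> h \<in> carrier G \<Longrightarrow>
      \<pi> (inv g) \<otimes>\<^bsub>A\<^esub> \<pi> (g \<otimes> h) = \<pi> (inv g) \<otimes>\<^bsub>A\<^esub> \<pi> g \<otimes>\<^bsub>A\<^esub> \<pi> h"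
    and pi_right: "g \<in> carrier G \<Longrightarrow> h \<in> carrier G \<Longrightarrow>
      \<pi> (g \<otimes> h) \<otimes>\<^bsub>A\<^esub> \<pi> (inv h) = \<pi> g \<otimes>\<^bsub>A\<^esub> \<pi> h \<otimes>\<^bsub>A\<^esub> \<pi> (inv h)"
    and pi_global: "g \<in> H \<Longrightarrow> h \<in> H \<Longrightarrow> \<pi> (g \<otimes> h) = \<pi> g \<otimes>\<^bsub>A\<^esub> \<pi> h"
begin

section \<open>The commuting idempotents of a partial representation\<close>

definition e :: "'g \<Rightarrow> 'a" where
  "e g = \<pi> g \<otimes>\<^bsub>A\<^esub> \<pi> (inv g)"

lemma e_closed [simp]: "g \<in> carrier G \<Longrightarrow> e g \<in> carrier A"
  by (simp add: e_def)

text \<open>This is the relation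
  \<open>\<pi> g \<otimes> \<pi> (inv g) \<otimes> \<pi> g = \<pi> g\<close>, obtained from
  \<open>pi_left\<close> at the pair \<open>inv g\<close>, g.\<close>

lemma pi_e: "g \<in> carrier G \<Longrightarrow> \<pi> g \<otimes>\<^bsub>A\<^esub> e (inv g) = \<pi> g"
  using pi_left[of "inv g" g] by (simp add: e_def pi_one A.m_assoc)

lemma e_idem: "g \<in> carrier G \<Longrightarrow> e g \<otimes>\<^bsub>A\<^esub> e g = e g"
  using pi_e[of g] by (simp add: e_def flip: A.m_assoc)

text \<open>Both sides equal \<open>\<pi> (g \<otimes> h) \<otimes> \<pi> (inv h)\<close>: the left
  one by \<open>pi_right\<close>, the right one by \<open>pi_left\<close> at the pair
  \<open>inv (g \<otimes> h)\<close>, g.\<close>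

lemma pi_e_commute:
  assumes "g \<in> carrier G" "h \<in> carrier G"
  shows "\<pi> g \<otimes>\<^bsub>A\<^esub> e h = e (g \<otimes> h) \<otimes>\<^bsub>A\<^esub> \<pi> g"
proof -
  have "\<pi> g \<otimes>\<^bsub>A\<^esub> e h = \<pi> (g \<otimes> h) \<otimes>\<^bsub>A\<^esub> \<pi> (inv h)"
    using assms pi_right[of g h] by (simp add: e_def A.m_assoc)
  also have "\<dots> = e (g \<otimes> h) \<otimes>\<^bsub>A\<^esub> \<pi> g"
    using assms pi_left[of "inv (g \<otimes> h)" g] by (simp add: e_def inv_mult_group m_assoc)
  finally show ?thesis .
qed

text \<open>Move \<open>e h\<close> to the left past \<open>\<pi> (inv g)\<close> and then past
  \<open>\<pi> g\<close>; the two translations cancel.\<close>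

lemma e_commute:
  assumes "g \<in> carrier G" "h \<in> carrier G"
  shows "e g \<otimes>\<^bsub>A\<^esub> e h = e h \<otimes>\<^bsub>A\<^esub> e g"
proof -
  have "e g \<otimes>\<^bsub>A\<^esub> e h = \<pi> g \<otimes>\<^bsub>A\<^esub> (\<pi> (inv g) \<otimes>\<^bsub>A\<^esub> e h)"
    using assms by (simp add: e_def[of g] A.m_assoc)
  also have "\<dots> = \<pi> g \<otimes>\<^bsub>A\<^esub> e (inv g \<otimes> h) \<otimes>\<^bsub>A\<^esub> \<pi> (inv g)"
    using assms by (simp add: pi_e_commute[of "inv g" h] A.m_assoc)
  also have "\<pi> g \<otimes>\<^bsub>A\<^esub> e (inv g \<otimes> h) = e h \<otimes>\<^bsub>A\<^esub> \<pi> g"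
    using assms by (simp add: pi_e_commute flip: m_assoc)
  also have "\<dots> \<otimes>\<^bsub>A\<^esub> \<pi> (inv g) = e h \<otimes>\<^bsub>A\<^esub> e g"
    using assms by (simp add: A.m_assoc e_def[of g])
  finally show ?thesis .
qed

text \<open>Globality enters here: \<open>\<pi> h\<close> and \<open>\<pi> (inv h)\<close> are
  mutually inverse for h in H.\<close>

lemma e_subgroup: "h \<in> H \<Longrightarrow> e h = \<one>\<^bsub>A\<^esub>"
  using pi_global[of h "inv h"] by (simp add: e_def pi_one mem_carrier)

text \<open>Invertibility of \<open>\<pi> h\<close> allows cancellation in the partial relations.
  Hence \<open>\<pi> (x \<otimes> h)\<close> and \<open>\<pi> (inv h \<otimes> inv x)\<close> factor
  completely, and the two inner factors of their product cancel.\<close>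

lemma e_right_coset:
  assumes x: "x \<in> carrier G" and h: "h \<in> H"
  shows "e (x \<otimes> h) = e x"
proof -
  have hG: "h \<in> carrier G" and e1: "\<pi> h \<otimes>\<^bsub>A\<^esub> \<pi> (inv h) = \<one>\<^bsub>A\<^esub>"
    using h e_subgroup[of h] by (auto simp: e_def)
  have e2: "\<pi> (inv h) \<otimes>\<^bsub>A\<^esub> \<pi> h = \<one>\<^bsub>A\<^esub>"
    using h e_subgroup[of "inv h"] hG by (auto simp: e_def)
  have "\<pi> (x \<otimes> h) = \<pi> (x \<otimes> h) \<otimes>\<^bsub>A\<^esub> \<pi> (inv h) \<otimes>\<^bsub>A\<^esub> \<pi> h"
    using x hG by (simp add: A.m_assoc e2)
  also have "\<dots> = \<pi> x \<otimes>\<^bsub>A\<^esub> \<pi> h"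
    using x hG by (simp add: pi_right e2 A.m_assoc)
  finally have 1: "\<pi> (x \<otimes> h) = \<pi> x \<otimes>\<^bsub>A\<^esub> \<pi> h" .
  have "\<pi> (inv h \<otimes> inv x) = \<pi> (inv h) \<otimes>\<^bsub>A\<^esub> (\<pi> h \<otimes>\<^bsub>A\<^esub> \<pi> (inv h \<otimes> inv x))"
    using x hG by (simp add: e2 flip: A.m_assoc)
  also have "\<pi> h \<otimes>\<^bsub>A\<^esub> \<pi> (inv h \<otimes> inv x) = \<pi> (inv x)"
    using x hG pi_left[of "inv h" "inv x"] by (simp add: e1)
  finally show ?thesis
    using x hG e1 by (simp add: e_def inv_mult_group 1 A.m_assoc[symmetric]) (simp add: A.m_assoc)
qed

section \<open>The resolution of the unit attached to the idempotents\<close>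

definition F :: "'g set \<Rightarrow> 'a" where
  "F = (SOME F. resolution A (carrier G) e F)"

lemma resolution_F: "resolution A (carrier G) e F"
proof -
  have "\<exists>F. resolution A (carrier G) e F"
    using A.resolution_exists_commuting[of "carrier G" e]
    by (auto simp: finite_carrier e_idem e_commute)
  then show ?thesis
    unfolding F_def by (rule someI_ex)
qed

lemma F_closed [simp]: "B \<subseteq> carrier G \<Longrightarrow> F B \<in> carrier A"
  and e_F: "B \<subseteq> carrier G \<Longrightarrow> x \<in> carrier G \<Longrightarrow> e x \<otimes>\<^bsub>A\<^esub> F B = (if x \<in> B then F B else \<zero>\<^bsub>A\<^esub>)"
  and sum_F: "(\<Oplus>\<^bsub>A\<^esub>B\<in>Pow (carrier G). F B) = \<one>\<^bsub>A\<^esub>"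
  using resolution_F by (auto simp: resolution_def)

text \<open>If B is not in \<open>\<P>\<close>, one idempotent acts on \<open>F B\<close> both as 1
  and as 0: either \<open>e h = \<one>\<close> with h outside B, or
  \<open>e x = e (x \<otimes> h)\<close> with only x in B.\<close>

lemma F_eq_zero:
  assumes B: "B \<subseteq> carrier G" and "B \<notin> \<P>"
  shows "F B = \<zero>\<^bsub>A\<^esub>"
proof -
  consider h where "h \<in> H" "h \<notin> B" | x h where "x \<in> B" "h \<in> H" "x \<otimes> h \<notin> B"
    using assms by (auto simp: coset_unions_iff)
  then show ?thesis
  proof cases
    case 1
    then show ?thesis
      using e_F[OF B, of h] e_subgroup[of h] B by simp
  next
    case 2
    then show ?thesis
      using e_F[OF B, of x] e_F[OF B, of "x \<otimes> h"] e_right_coset[of x h] B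
      by (auto simp: subset_iff split: if_splits)
  qed
qed

text \<open>By \<open>pi_e_commute\<close>, \<open>\<pi> h\<close> moves the idempotents by left
  translation. The resulting condition \<open>C = h <# B\<close> is the composability condition of
  the groupoid.\<close>

lemma F_transport:
  assumes h: "h \<in> carrier G" and B: "B \<subseteq> carrier G" and C: "C \<subseteq> carrier G"
  shows "F C \<otimes>\<^bsub>A\<^esub> (\<pi> h \<otimes>\<^bsub>A\<^esub> F B) = (if C = h <# B then \<pi> h \<otimes>\<^bsub>A\<^esub> F B else \<zero>\<^bsub>A\<^esub>)"
proof -
  have "bij_betw ((\<otimes>) h) (carrier G) (carrier G)"
    using h by (simp add: bij_betw_def inj_on_multc inj_on_cmult surj_const_mult)
  moreover have "h <# B = (\<otimes>) h ` B"
    by (auto simp: l_coset_def)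
  ultimately show ?thesis
    using A.resolution_transport[OF resolution_F finite_carrier, of "\<pi> h" "(\<otimes>) h" C B] assms pi_e_commute
    by simp
qed

definition basis_image :: "'g set \<times> 'g \<Rightarrow> 'a" where
  "basis_image = (\<lambda>(B, g). \<pi> g \<otimes>\<^bsub>A\<^esub> F B)"

lemma basis_image_closed [simp]: "x \<in> Gamma G H \<Longrightarrow> basis_image x \<in> carrier A"
  by (cases x) (auto simp: Gamma_def basis_image_def coset_unions_subset)

text \<open>\<open>F_transport\<close> decides whether the product vanishes. On \<open>F B\<close>
  the map \<pi> is multiplicative, because \<open>inv h \<in> B\<close> makes
  \<open>e (inv h)\<close> act there as the unit.\<close>

lemma basis_image_mult:
  assumes g: "(C, g) \<in> Gamma G H" and h: "(B, h) \<in> Gamma G H"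
  shows "basis_image (C, g) \<otimes>\<^bsub>A\<^esub> basis_image (B, h) =
    (if C = h <# B then basis_image (B, g \<otimes> h) else \<zero>\<^bsub>A\<^esub>)"
proof -
  have hB: "inv h \<in> B" and G: "B \<subseteq> carrier G" "C \<subseteq> carrier G" "g \<in> carrier G" "h \<in> carrier G"
    using assms by (auto simp: Gamma_def coset_unions_subset)
  have "\<pi> g \<otimes>\<^bsub>A\<^esub> (\<pi> h \<otimes>\<^bsub>A\<^esub> F B) = \<pi> (g \<otimes> h) \<otimes>\<^bsub>A\<^esub> F B"
  proof -
    \<comment> \<open>Absorbing \<open>e (inv h)\<close> supplies the factor
      \<open>\<pi> (inv h)\<close> that \<open>pi_right\<close> requires.\<close>
    have eF: "F B = \<pi> (inv h) \<otimes>\<^bsub>A\<^esub> (\<pi> h \<otimes>\<^bsub>A\<^esub> F B)"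
      using e_F[OF G(1), of "inv h"] hB G by (simp add: e_def A.m_assoc)
    have "\<pi> (g \<otimes> h) \<otimes>\<^bsub>A\<^esub> F B = \<pi> (g \<otimes> h) \<otimes>\<^bsub>A\<^esub> \<pi> (inv h) \<otimes>\<^bsub>A\<^esub> (\<pi> h \<otimes>\<^bsub>A\<^esub> F B)"
      using G by (subst eF) (simp add: A.m_assoc)
    also have "\<dots> = \<pi> g \<otimes>\<^bsub>A\<^esub> (\<pi> h \<otimes>\<^bsub>A\<^esub> (\<pi> (inv h) \<otimes>\<^bsub>A\<^esub> (\<pi> h \<otimes>\<^bsub>A\<^esub> F B)))"
      using G by (simp add: pi_right A.m_assoc)
    finally show ?thesis
      by (simp flip: eF)
  qed
  moreover have "basis_image (C, g) \<otimes>\<^bsub>A\<^esub> basis_image (B, h) = \<pi> g \<otimes>\<^bsub>A\<^esub> (F C \<otimes>\<^bsub>A\<^esub> (\<pi> h \<otimes>\<^bsub>A\<^esub> F B))"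
    using G by (simp add: basis_image_def A.m_assoc)
  ultimately show ?thesis
    using F_transport[OF G(4,1,2)] G by (simp add: basis_image_def)
qed

section \<open>The linear extension and its multiplicativity\<close>

definition lift :: "('g set \<times> 'g \<Rightarrow> complex) \<Rightarrow> 'a" where
  "lift = (\<lambda>a\<in>carrier (Gamma_alg G H). \<Oplus>\<^bsub>A\<^esub>x\<in>Gamma G H. a x \<odot>\<^bsub>A\<^esub> basis_image x)"

lemma A_smult_closed [simp]: "x \<in> carrier A \<Longrightarrow> c \<odot>\<^bsub>A\<^esub> x \<in> carrier A"
  using A.smult_closed by simp

lemma lift_closed: "a \<in> carrier (Gamma_alg G H) \<Longrightarrow> lift a \<in> carrier A"
  by (simp add: lift_def A.finsum_closed Pi_def)

lemma lift_add:
  assumes "a \<in> carrier (Gamma_alg G H)" "b \<in> carrier (Gamma_alg G H)"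
  shows "lift (a \<oplus>\<^bsub>Gamma_alg G H\<^esub> b) = lift a \<oplus>\<^bsub>A\<^esub> lift b"
proof -
  have "(\<Oplus>\<^bsub>A\<^esub>x\<in>Gamma G H. (a x + b x) \<odot>\<^bsub>A\<^esub> basis_image x) =
    (\<Oplus>\<^bsub>A\<^esub>x\<in>Gamma G H. a x \<odot>\<^bsub>A\<^esub> basis_image x \<oplus>\<^bsub>A\<^esub> b x \<odot>\<^bsub>A\<^esub> basis_image x)"
    using A.smult_l_distr by (intro A.finsum_cong') auto
  also have "\<dots> = lift a \<oplus>\<^bsub>A\<^esub> lift b"
    using assms by (simp add: lift_def A.finsum_addf Pi_def)
  finally show ?thesis
    using Gamma_alg_add_closed[OF assms] by (simp add: lift_def Gamma_alg_simps)
qed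

lemma lift_smult:
  assumes "a \<in> carrier (Gamma_alg G H)"
  shows "lift (c \<odot>\<^bsub>Gamma_alg G H\<^esub> a) = c \<odot>\<^bsub>A\<^esub> lift a"
proof -
  have "(\<Oplus>\<^bsub>A\<^esub>x\<in>Gamma G H. (c * a x) \<odot>\<^bsub>A\<^esub> basis_image x) =
    (\<Oplus>\<^bsub>A\<^esub>x\<in>Gamma G H. c \<odot>\<^bsub>A\<^esub> (a x \<odot>\<^bsub>A\<^esub> basis_image x))"
    using A.smult_assoc1 by (intro A.finsum_cong') auto
  also have "\<dots> = c \<odot>\<^bsub>A\<^esub> lift a"
    using assms by (simp add: lift_def A.finsum_smult_ldistr Pi_def)
  finally show ?thesis
    using Gamma_alg_smult_closed[OF assms] by (simp add: lift_def Gamma_alg_simps)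
qed

lemma lift_slice:
  assumes "g \<in> carrier G" "S \<subseteq> \<P>\<^sub>i g"
  shows "lift (slice S g) = (\<Oplus>\<^bsub>A\<^esub>B\<in>S. \<pi> g \<otimes>\<^bsub>A\<^esub> F B)"
proof -
  have sub: "(\<lambda>B. (B, g)) ` S \<subseteq> Gamma G H"
    using assms by (auto simp: Gamma_iff)
  have one: "1 \<odot>\<^bsub>A\<^esub> x = x" if "x \<in> carrier A" for x
    using A.smult_one that by simp
  have zero: "0 \<odot>\<^bsub>A\<^esub> x = \<zero>\<^bsub>A\<^esub>" if "x \<in> carrier A" for x
    using A.smult_l_null that by simp
  have "lift (slice S g) = (\<Oplus>\<^bsub>A\<^esub>x\<in>Gamma G H. slice S g x \<odot>\<^bsub>A\<^esub> basis_image x)"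
    using assms by (simp add: lift_def slice_closed)
  also have "\<dots> = (\<Oplus>\<^bsub>A\<^esub>x\<in>(\<lambda>B. (B, g)) ` S. basis_image x)"
  proof (rule A.add.finprod_mono_neutral_cong_right[OF finite_Gamma sub])
    fix x assume "x \<in> Gamma G H - (\<lambda>B. (B, g)) ` S"
    then show "slice S g x \<odot>\<^bsub>A\<^esub> basis_image x = \<zero>\<^bsub>A\<^esub>"
      by (cases x) (auto simp: slice_def intro!: zero)
  next
    fix x assume x: "x \<in> (\<lambda>B. (B, g)) ` S"
    then have "slice S g x = 1"
      by (auto simp: slice_def)
    then show "slice S g x \<odot>\<^bsub>A\<^esub> basis_image x = basis_image x"
      using one basis_image_closed[OF subsetD[OF sub x]] by simp
  qed auto
  also have "\<dots> = (\<Oplus>\<^bsub>A\<^esub>B\<in>S. basis_image (B, g))"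
    using sub by (intro A.finsum_reindex) (auto simp: inj_on_def)
  finally show ?thesis
    by (simp add: basis_image_def)
qed

lemma lift_basis: "(B, g) \<in> Gamma G H \<Longrightarrow> lift (slice {B} g) = basis_image (B, g)"
  using basis_image_closed[of "(B, g)"] by (simp add: lift_slice Gamma_iff basis_image_def)

lemma lift_zero: "lift \<zero>\<^bsub>Gamma_alg G H\<^esub> = \<zero>\<^bsub>A\<^esub>"
  using lift_slice[of \<one> "{}"] by (simp add: slice_def Gamma_alg_simps split_def)

text \<open>Expand \<open>\<pi> g = \<pi> g \<otimes> e (inv g)\<close> along the resolution. The
  factor \<open>e (inv g)\<close> removes all B without \<open>inv g\<close>, and
  \<open>F_eq_zero\<close> removes those outside \<open>\<P>\<close>; exactly the summands of
  \<open>mu_p G H g\<close> remain.\<close>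

lemma lift_mu_p:
  assumes g: "g \<in> carrier G"
  shows "lift (mu_p G H g) = \<pi> g"
proof -
  have inP: "\<P>\<^sub>i g \<subseteq> Pow (carrier G)"
    by (auto simp: \<P>\<^sub>i_def coset_unions_iff)
  have "\<pi> g = \<pi> g \<otimes>\<^bsub>A\<^esub> e (inv g) \<otimes>\<^bsub>A\<^esub> (\<Oplus>\<^bsub>A\<^esub>B\<in>Pow (carrier G). F B)"
    using g by (simp add: pi_e sum_F)
  also have "\<dots> = (\<Oplus>\<^bsub>A\<^esub>B\<in>Pow (carrier G). \<pi> g \<otimes>\<^bsub>A\<^esub> e (inv g) \<otimes>\<^bsub>A\<^esub> F B)"
    using g by (intro A.finsum_rdistr) (auto simp: finite_carrier)
  also have "\<dots> = (\<Oplus>\<^bsub>A\<^esub>B\<in>\<P>\<^sub>i g. \<pi> g \<otimes>\<^bsub>A\<^esub> F B)"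
  proof (rule A.add.finprod_mono_neutral_cong_right)
    fix B assume "B \<in> Pow (carrier G) - \<P>\<^sub>i g"
    then show "\<pi> g \<otimes>\<^bsub>A\<^esub> e (inv g) \<otimes>\<^bsub>A\<^esub> F B = \<zero>\<^bsub>A\<^esub>"
      using g F_eq_zero[of B] e_F[of B "inv g"] by (auto simp: \<P>\<^sub>i_def A.m_assoc)
  next
    fix B assume "B \<in> \<P>\<^sub>i g"
    then show "\<pi> g \<otimes>\<^bsub>A\<^esub> e (inv g) \<otimes>\<^bsub>A\<^esub> F B = \<pi> g \<otimes>\<^bsub>A\<^esub> F B"
      using g e_F[of B "inv g"] inP by (auto simp: \<P>\<^sub>i_def A.m_assoc coset_unions_subset)
  qed (use g inP finite_carrier in auto)
  also have "\<dots> = lift (mu_p G H g)"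
    using g by (simp add: mu_p_eq_slice lift_slice)
  finally show ?thesis ..
qed

text \<open>By bilinearity it suffices to treat pairs of basis elements. The right factor is
  generalised first, then the left one.\<close>

lemma lift_mult:
  assumes "a \<in> carrier (Gamma_alg G H)" "b \<in> carrier (Gamma_alg G H)"
  shows "lift (a \<otimes>\<^bsub>Gamma_alg G H\<^esub> b) = lift a \<otimes>\<^bsub>A\<^esub> lift b"
proof -
  note clos = Gamma_alg_mult_closed lift_closed
  have basis_case: "lift (slice {C} g \<otimes>\<^bsub>Gamma_alg G H\<^esub> slice {B} h) = lift (slice {C} g) \<otimes>\<^bsub>A\<^esub> lift (slice {B} h)"
    if "(C, g) \<in> Gamma G H" "(B, h) \<in> Gamma G H" for C g B h
  proof -
    have G: "g \<in> carrier G" "h \<in> carrier G" "C \<in> \<P>\<^sub>i g" "B \<in> \<P>\<^sub>i h"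
      using that by (auto simp: Gamma_iff)
    have prod: "slice {C} g \<otimes>\<^bsub>Gamma_alg G H\<^esub> slice {B} h =
        slice {B' \<in> {B}. h <# B' \<in> {C}} (g \<otimes> h)"
      using G by (intro slice_mult) auto
    show ?thesis
    proof (cases "C = h <# B")
      case True
      then have "slice {C} g \<otimes>\<^bsub>Gamma_alg G H\<^esub> slice {B} h = slice {B} (g \<otimes> h)"
        using prod by (simp add: conj_commute cong: conj_cong)
      moreover have "(B, g \<otimes> h) \<in> Gamma G H"
        using \<P>\<^sub>i_mult[of g h] G True by (auto simp: Gamma_iff)
      ultimately show ?thesis
        using basis_image_mult[OF that] True lift_basis that by simp
    next
      case False
      then have "slice {C} g \<otimes>\<^bsub>Gamma_alg G H\<^esub> slice {B} h = \<zero>\<^bsub>Gamma_alg G H\<^esub>"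
        unfolding prod by (auto simp: slice_def Gamma_alg_simps)
      then show ?thesis
        using basis_image_mult[OF that] False lift_basis that lift_zero by simp
    qed
  qed
  have left: "lift (slice {C} g \<otimes>\<^bsub>Gamma_alg G H\<^esub> b) = lift (slice {C} g) \<otimes>\<^bsub>A\<^esub> lift b"
    if Cg: "(C, g) \<in> Gamma G H" for C g
  proof -
    have [simp]: "lift (slice {C} g) \<in> carrier A"
      using Cg by (simp add: lift_basis)
    show ?thesis
      using assms(2)
    proof (induction rule: Gamma_alg_induct)
      case (basis B h)
      then show ?case
        using Cg by (intro basis_case)
    qed (simp_all add: Gamma_alg_bilinear lift_zero lift_add lift_smult clos A.r_distr A.mult_smult)
  qed
  show ?thesis
    using assms(1)
    by (induction rule: Gamma_alg_induct)
      (simp_all add: left Gamma_alg_bilinear lift_zero lift_add lift_smult clos assms A.l_distr A.smult_mult)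
qed

lemma lift_alg_hom: "lift \<in> alg_homs (Gamma_alg G H) A"
proof -
  have "lift \<one>\<^bsub>Gamma_alg G H\<^esub> = \<one>\<^bsub>A\<^esub>"
    using lift_mu_p[of \<one>] by (simp add: mu_p_one pi_one)
  moreover have "lift \<in> extensional (carrier (Gamma_alg G H))"
    by (simp add: lift_def)
  ultimately show ?thesis
    by (auto simp: alg_homs_def Ring.ring_hom_def LinearCombinations.module_hom_def
        lift_closed lift_mult lift_add lift_smult)
qed

end

section \<open>The correspondence\<close>

context finite_group_with_subgroup
begin

section \<open>From algebra homomorphisms to partial representations and back\<close>

text \<open>The required identities hold for \<open>mu_p\<close> inside the groupoid algebra, and a
  homomorphism transports them. On H the map \<open>mu_p\<close> is multiplicative because every set
  in \<open>\<P>\<close> contains H.\<close>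

lemma global_partial_rep_of_alg_hom:
  assumes V: "fin_dim_vs V" and \<rho>: "\<rho> \<in> alg_homs (Gamma_alg G H) (End_alg V)"
  shows "global_partial_rep G H V (compose (carrier G) \<rho> (mu_p G H))"
proof -
  interpret A: assoc_algebra "End_alg V"
    by (rule fin_dim_vs_End_alg[OF V])
  note hom = A.alg_homsD[OF \<rho>]
  define \<pi> where "\<pi> = compose (carrier G) \<rho> (mu_p G H)"
  have pi: "\<pi> g = \<rho> (mu_p G H g)" if "g \<in> carrier G" for g
    using that by (simp add: \<pi>_def compose_eq)
  have closed: "\<pi> g \<in> carrier (End_alg V)" if "g \<in> carrier G" for g
    using that by (simp add: pi hom(1) mu_p_closed)
  have one: "\<pi> \<one> = \<one>\<^bsub>End_alg V\<^esub>"
    by (simp add: pi mu_p_one hom(5))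
  note mult = hom(3)[symmetric] Gamma_alg_mult_closed mu_p_closed
  have global: "\<pi> g \<otimes>\<^bsub>End_alg V\<^esub> \<pi> h = \<pi> (g \<otimes> h)" if "g \<in> H" "h \<in> H" for g h
  proof -
    have "mu_p G H g \<otimes>\<^bsub>Gamma_alg G H\<^esub> mu_p G H h = mu_p G H (g \<otimes> h)"
      using that by (simp add: mu_p_mult \<P>\<^sub>i_subgroup mem_carrier mu_p_eq_slice[of "g \<otimes> h"])
    then show ?thesis
      using that by (simp add: pi mult mem_carrier)
  qed
  \<comment> \<open>Multiplicativity on H makes \<open>\<pi> (inv h)\<close> a two-sided
    inverse.\<close>
  have unit: "\<pi> h \<in> Units (End_alg V)" if "h \<in> H" for h
    using that global[of h "inv h"] global[of "inv h" h] closed[of h] closed[of "inv h"] one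
    by (auto simp: Units_def mem_carrier)
  have "partial_rep G V \<pi>"
    unfolding partial_rep_def
  proof (intro conjI ballI)
    show "\<pi> \<in> carrier G \<rightarrow>\<^sub>E carrier (End_alg V)"
      using closed by (auto simp: \<pi>_def compose_def)
  next
    fix g h assume "g \<in> carrier G" "h \<in> carrier G"
    then show "\<pi> (inv g) \<otimes>\<^bsub>End_alg V\<^esub> \<pi> (g \<otimes> h) =
      \<pi> (inv g) \<otimes>\<^bsub>End_alg V\<^esub> \<pi> g \<otimes>\<^bsub>End_alg V\<^esub> \<pi> h"
      by (simp add: pi mult mu_p_left)
  next
    fix g h assume "g \<in> carrier G" "h \<in> carrier G"
    then show "\<pi> (g \<otimes> h) \<otimes>\<^bsub>End_alg V\<^esub> \<pi> (inv h) =
      \<pi> g \<otimes>\<^bsub>End_alg V\<^esub> \<pi> h \<otimes>\<^bsub>End_alg V\<^esub> \<pi> (inv h)"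
      by (simp add: pi mult mu_p_right)
  qed (use V one in auto)
  moreover have "restrict \<pi> H \<in> hom (G\<lparr>carrier := H\<rparr>) (units_of (End_alg V))"
    using unit global by (auto simp: hom_def units_of_def)
  ultimately show ?thesis
    by (simp add: global_partial_rep_def \<pi>_def)
qed

lemma partial_hom_of_global_partial_rep:
  assumes "global_partial_rep G H V \<pi>"
  shows "partial_hom G H (End_alg V) \<pi>"
proof -
  have \<pi>: "partial_rep G V \<pi>" "restrict \<pi> H \<in> hom (G\<lparr>carrier := H\<rparr>) (units_of (End_alg V))"
    using assms by (auto simp: global_partial_rep_def)
  interpret A: assoc_algebra "End_alg V"
    using \<pi> by (intro fin_dim_vs_End_alg) (simp add: partial_rep_def)
  show ?thesis
  proof
    fix g h assume "g \<in> H" "h \<in> H"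
    then show "\<pi> (g \<otimes> h) = \<pi> g \<otimes>\<^bsub>End_alg V\<^esub> \<pi> h"
      using \<pi>(2) by (auto simp: hom_def units_of_def)
  qed (use \<pi>(1) in \<open>auto simp: partial_rep_def\<close>)
qed

lemma alg_hom_exists:
  assumes "global_partial_rep G H V \<pi>"
  shows "\<exists>\<rho>\<in>alg_homs (Gamma_alg G H) (End_alg V). \<pi> = compose (carrier G) \<rho> (mu_p G H)"
proof -
  interpret partial_hom G H "End_alg V" \<pi>
    by (rule partial_hom_of_global_partial_rep[OF assms])
  have "\<pi> \<in> extensional (carrier G)"
    using assms by (auto simp: global_partial_rep_def partial_rep_def PiE_def)
  then have "\<pi> = compose (carrier G) lift (mu_p G H)"
    by (intro extensionalityI[of _ "carrier G"]) (auto simp: compose_eq lift_mu_p)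
  then show ?thesis
    using lift_alg_hom by blast
qed

section \<open>Intertwiners and uniqueness\<close>

text \<open>Serves twice: the identity as f yields uniqueness of the homomorphism, and general f
  shows that the inverse functor preserves morphisms.\<close>

lemma intertwines_Gamma_alg:
  assumes V: "fin_dim_vs V" and W: "fin_dim_vs W"
    and \<rho>: "\<rho> \<in> alg_homs (Gamma_alg G H) (End_alg V)"
    and \<sigma>: "\<sigma> \<in> alg_homs (Gamma_alg G H) (End_alg W)"
    and f: "f \<in> linear_maps V W"
    and eq: "\<And>g. g \<in> carrier G \<Longrightarrow>
      compose (carrier V) f (\<rho> (mu_p G H g)) = compose (carrier V) (\<sigma> (mu_p G H g)) f"
    and a: "a \<in> carrier (Gamma_alg G H)"
  shows "compose (carrier V) f (\<rho> a) = compose (carrier V) (\<sigma> a) f"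
proof -
  note hom\<rho> = assoc_algebra.alg_homsD[OF fin_dim_vs_End_alg[OF V] \<rho>, unfolded End_alg_simps]
  note hom\<sigma> = assoc_algebra.alg_homsD[OF fin_dim_vs_End_alg[OF W] \<sigma>, unfolded End_alg_simps]
  note f = linear_mapsD(1-3)[OF f]
  \<comment> \<open>The vector is generalised because the product case uses the hypothesis for a at
    \<open>\<rho> b v\<close>.\<close>
  have "f (\<rho> a v) = \<sigma> a (f v)" if "v \<in> carrier V" for v
    using a that
  proof (induction arbitrary: v rule: Gamma_alg_generated)
    case (mu_p g)
    then show ?case
      using fun_cong[OF eq[OF mu_p(1)], of v] by (simp add: compose_eq)
  next
    case (add a b)
    then show ?case
      using linear_mapsD(1)[OF hom\<rho>(1)] by (simp add: hom\<rho> hom\<sigma> f)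
  next
    case (smult c a)
    then show ?case
      using linear_mapsD(1)[OF hom\<rho>(1)] by (simp add: hom\<rho> hom\<sigma> f)
  next
    case (mult a b)
    then show ?case
      using linear_mapsD(1)[OF hom\<rho>(1)] by (simp add: hom\<rho> hom\<sigma> f compose_eq)
  qed
  then show ?thesis
    by (simp add: compose_def cong: restrict_cong)
qed

text \<open>The identity map intertwines \<rho> and \<sigma> on the image of \<open>mu_p\<close>,
  hence on the whole algebra.\<close>

lemma alg_hom_unique:
  assumes V: "fin_dim_vs V"
    and \<rho>: "\<rho> \<in> alg_homs (Gamma_alg G H) (End_alg V)"
    and \<sigma>: "\<sigma> \<in> alg_homs (Gamma_alg G H) (End_alg V)"
    and eq: "compose (carrier G) \<rho> (mu_p G H) = compose (carrier G) \<sigma> (mu_p G H)"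
  shows "\<rho> = \<sigma>"
proof -
  interpret A: assoc_algebra "End_alg V"
    by (rule fin_dim_vs_End_alg[OF V])
  have id: "(\<lambda>v\<in>carrier V. v) \<in> linear_maps V V"
    by (rule id_linear_maps[OF fin_dim_vs_module[OF V]])
  have mu: "\<rho> (mu_p G H g) = \<sigma> (mu_p G H g)" if "g \<in> carrier G" for g
    using fun_cong[OF eq, of g] that by (simp add: compose_eq)
  note homD = A.alg_homsD[unfolded End_alg_simps]
  have left: "compose (carrier V) (\<lambda>v\<in>carrier V. v) u = u"
    and right: "compose (carrier V) u (\<lambda>v\<in>carrier V. v) = u" if "u \<in> linear_maps V V" for u
    using A.l_one[of u] A.r_one[of u] that by (simp_all add: End_alg_simps)
  have "\<rho> a = \<sigma> a" if a: "a \<in> carrier (Gamma_alg G H)" for a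
    using intertwines_Gamma_alg[OF V V \<rho> \<sigma> id _ a] homD(1)[OF \<rho>] homD(1)[OF \<sigma>] a
    by (simp add: left right mu mu_p_closed)
  then show ?thesis
    using homD(6)[OF \<rho>] homD(6)[OF \<sigma>] by (intro extensionalityI[of _ "carrier (Gamma_alg G H)"]) auto
qed

lemma ex1_alg_hom:
  assumes "global_partial_rep G H V \<pi>"
  shows "\<exists>!\<rho>. \<rho> \<in> alg_homs (Gamma_alg G H) (End_alg V) \<and> \<pi> = compose (carrier G) \<rho> (mu_p G H)"
proof -
  have V: "fin_dim_vs V"
    using assms by (simp add: global_partial_rep_def partial_rep_def)
  show ?thesis
    using alg_hom_exists[OF assms] alg_hom_unique[OF V] by (intro ex_ex1I) auto
qed

end

theorem corollary3p10:
  fixes G :: "('g, 'b) monoid_scheme" and H :: "'g set"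
  assumes "group G" and "finite (carrier G)" and "subgroup H G"
  shows
    "isomorphism_of_categories
       (alg_rep_category (Gamma_alg G H) ::
          ((complex, 'v) module \<times> (('g set \<times> 'g \<Rightarrow> complex) \<Rightarrow> 'v \<Rightarrow> 'v), 'v \<Rightarrow> 'v) cat)
       (global_partial_rep_category G H)
       (\<lambda>(V, \<rho>). (V, compose (carrier G) \<rho> (mu_p G H)))
       (\<lambda>_ _ f. f)
     \<and> (\<forall>(V :: (complex, 'v) module) \<rho>.
          fin_dim_vs V \<longrightarrow> \<rho> \<in> alg_homs (Gamma_alg G H) (End_alg V) \<longrightarrow>
          global_partial_rep G H V (compose (carrier G) \<rho> (mu_p G H)))
     \<and> (\<forall>(V :: (complex, 'v) module) \<pi>.
          global_partial_rep G H V \<pi> \<longrightarrow>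
          (\<exists>!\<rho>. \<rho> \<in> alg_homs (Gamma_alg G H) (End_alg V) \<and>
                 \<pi> = compose (carrier G) \<rho> (mu_p G H)))"
proof -
  interpret finite_group_with_subgroup G H
    using assms by (simp add: finite_group_with_subgroup_def finite_group_with_subgroup_axioms_def)
  let ?\<A> = "Gamma_alg G H"
  let ?obs = "{(V, \<rho>). fin_dim_vs V \<and> \<rho> \<in> alg_homs ?\<A> (End_alg V)} ::
    ((complex, 'v) module \<times> (('g set \<times> 'g \<Rightarrow> complex) \<Rightarrow> 'v \<Rightarrow> 'v)) set"
  let ?obs' = "{(V, \<pi>). global_partial_rep G H V \<pi>} :: ((complex, 'v) module \<times> ('g \<Rightarrow> 'v \<Rightarrow> 'v)) set"
  \<comment> \<open>This is the object part of the inverse functor, well defined by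
    \<open>ex1_alg_hom\<close>.\<close>
  define ext where "ext V \<pi> =
    (THE \<rho>. \<rho> \<in> alg_homs ?\<A> (End_alg V) \<and> \<pi> = compose (carrier G) \<rho> (mu_p G H))"
    for V :: "(complex, 'v) module" and \<pi>
  have ext: "ext V \<pi> \<in> alg_homs ?\<A> (End_alg V)" "compose (carrier G) (ext V \<pi>) (mu_p G H) = \<pi>"
    if "global_partial_rep G H V \<pi>" for V \<pi>
    using theI'[OF ex1_alg_hom[OF that]] unfolding ext_def by simp_all
  have fin_dim: "fin_dim_vs V" if "global_partial_rep G H V \<pi>" for V :: "(complex, 'v) module" and \<pi>
    using that by (simp add: global_partial_rep_def partial_rep_def)
  have ext_compose: "ext V (compose (carrier G) \<rho> (mu_p G H)) = \<rho>"
    if "fin_dim_vs V" "\<rho> \<in> alg_homs ?\<A> (End_alg V)" for V \<rho>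
    using alg_hom_unique[OF that(1)] ext global_partial_rep_of_alg_hom[OF that] that(2) by blast
  have ext_mu: "ext V \<pi> (mu_p G H g) = \<pi> g" if "global_partial_rep G H V \<pi>" "g \<in> carrier G" for V \<pi> g
    using fun_cong[OF ext(2)[OF that(1)], of g] that by (simp add: compose_eq)
  have alg_hom_linear: "\<rho> a \<in> linear_maps V V"
    if "fin_dim_vs V" "\<rho> \<in> alg_homs ?\<A> (End_alg V)" "a \<in> carrier ?\<A>"
    for V :: "(complex, 'v) module" and \<rho> a
    using assoc_algebra.alg_homsD(1)[OF fin_dim_vs_End_alg[OF that(1)] that(2,3)]
    by (simp add: End_alg_simps)
  have cat: "is_category (rep_category (carrier ?\<A>) ?obs)"
    by (intro is_category_rep_category) (auto simp: alg_hom_linear)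
  have cat': "is_category (rep_category (carrier G) ?obs')"
    using fin_dim
    by (intro is_category_rep_category) (auto simp: global_partial_rep_def partial_rep_def End_alg_simps)
  have fun_to: "is_functor (rep_category (carrier ?\<A>) ?obs) (rep_category (carrier G) ?obs')
    (\<lambda>(V, \<rho>). (V, compose (carrier G) \<rho> (mu_p G H))) (\<lambda>_ _ f. f)"
    using cat cat'
    by (rule is_functor_rep_category) (auto simp: global_partial_rep_of_alg_hom mu_p_closed compose_eq)
  have fun_from: "is_functor (rep_category (carrier G) ?obs') (rep_category (carrier ?\<A>) ?obs)
    (\<lambda>(V, \<pi>). (V, ext V \<pi>)) (\<lambda>_ _ f. f)"
    using cat' cat
  proof (rule is_functor_rep_category)
    fix V W :: "(complex, 'v) module" and \<pi> \<pi>' f a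
    assume V: "(V, \<pi>) \<in> ?obs'" and W: "(W, \<pi>') \<in> ?obs'" and f: "f \<in> linear_maps V W"
      and eq: "\<And>g. g \<in> carrier G \<Longrightarrow> compose (carrier V) f (\<pi> g) = compose (carrier V) (\<pi>' g) f"
      and a: "a \<in> carrier ?\<A>"
    have VW: "global_partial_rep G H V \<pi>" "global_partial_rep G H W \<pi>'"
      using V W by simp_all
    show "compose (carrier V) f (ext V \<pi> a) = compose (carrier V) (ext W \<pi>' a) f"
    proof (rule intertwines_Gamma_alg[OF fin_dim[OF VW(1)] fin_dim[OF VW(2)]
          ext(1)[OF VW(1)] ext(1)[OF VW(2)] f _ a])
      show "compose (carrier V) f (ext V \<pi> (mu_p G H g)) = compose (carrier V) (ext W \<pi>' (mu_p G H g)) f"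
        if "g \<in> carrier G" for g
        using that by (simp only: ext_mu[OF VW(1)] ext_mu[OF VW(2)] eq)
    qed
  qed (auto intro: ext(1) fin_dim)
  \<comment> \<open>Both functors fix morphisms, so only the objects remain: \<open>ext\<close> and
    restriction along \<open>mu_p\<close> undo each other.\<close>
  have "isomorphism_of_categories (rep_category (carrier ?\<A>) ?obs) (rep_category (carrier G) ?obs')
    (\<lambda>(V, \<rho>). (V, compose (carrier G) \<rho> (mu_p G H))) (\<lambda>_ _ f. f)"
    unfolding isomorphism_of_categories_def
    using fun_to fun_from
    by (intro conjI exI[of _ "\<lambda>(V, \<pi>). (V, ext V \<pi>)"] exI[of _ "\<lambda>_ _ f. f"])
      (auto simp: is_left_inverse_functor_def rep_category_def ext ext_compose)
  then show ?thesis
    unfolding alg_rep_category_def global_partial_rep_category_def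
    using global_partial_rep_of_alg_hom ex1_alg_hom by blast
qed

end
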